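(* Let $d\ge1$, $1\le p<\infty$ and $\gamma\in\mathbb{R}\setminus[-d,0]$. There is a constant $C$ depending only on $d,p,\gamma$ such that for every convex domain $\Omega\subset\mathbb{R}^d$ with finite ball deviation $\mathrm{dev}(\Omega)$, every $f\in C^1(\Omega)$ and every $\lambda>0$ the following hold. (i) For every pair of weights $(u,w)\in A_1(\Omega)$, $$\mu^u_\gamma\big(E_{\lambda,\gamma/p}(f)\big)\le C\,[u,w]_{A_1(\Omega)}\Big(\frac{\mathrm{dev}(\Omega)}{\lambda}\Big)^{p}\int_\Omega|\nabla f(y)|^p\,w(y)\,dy .$$ (ii) In particular, for every nonnegative locally integrable function $u$ on $\Omega$, $$\mu^u_\gamma\big(E_{\lambda,\gamma/p}(f)\big)\le C\,\Big(\frac{\mathrm{dev}(\Omega)}{\lambda}\Big)^{p}\int_\Omega|\nabla f(y)|^p\,M_\Omega u(y)\,dy .$$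
   Context: A domain is a nonempty open connected set. The ball deviation of $\Omega\subset\mathbb{R}^d$ is $$\mathrm{dev}(\Omega)=\sup_{x\in\Omega}\ \sup_{0<r\le\mathrm{diam}(\Omega)}\frac{|B(x,r)|}{|B(x,r)\cap\Omega|},$$ where $\mathrm{diam}(\Omega)=\sup_{x,y\in\Omega}|x-y|\in(0,\infty]$, $r$ is finite, $B(x,r)$ is the ball of center $x$ and radius $r$, and $|E|$ is Lebesgue measure. For $b\in\mathbb{R}$ and $x\ne y$ in $\Omega$ put $\mathfrak{D}_bf(x,y)=\frac{|f(y)-f(x)|}{|y-x|^{1+b}}$, and $\mathfrak{D}_bf(x,x)=0$. For $\lambda>0$, $E_{\lambda,b}(f)=\{(x,y)\in\Omega\times\Omega:\mathfrak{D}_bf(x,y)>\lambda\}$. For a nonnegative measurable function $u$ on $\Omega$, $\mu^u_\gamma$ is the measure on $\Omega\times\Omega$ given by $d\mu^u_\gamma(x,y)=u(x)|y-x|^{\gamma-d}\,dx\,dy$. Weights $u,w$ are measurable functions on $\Omega$ with values in $[0,\infty)$. $(u,w)\in A_1(\Omega)$ means that there is a constant $K<\infty$ with $\frac1{|B|}\int_{B\cap\Omega}u(x)\,dx\le K\,\operatorname{ess\,inf}_{y\in B\cap\Omega}w(y)$ for every ball $B\subset\mathbb{R}^d$; $[u,w]_{A_1(\Omega)}$ is the infimum of all such $K$. The maximal function is $M_\Omega u(x)=\sup_{B\ni x}\frac1{|B|}\int_{B\cap\Omega}|u(y)|\,dy\in[0,\infty]$, the supremum over all balls $B\subset\mathbb{R}^d$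 containing $x$. The convention $0\cdot\infty=0$ is used in integrands. *)

theory Defs
  imports "HOL-Analysis.Analysis"
begin

definition domain_set :: "'a::topological_space set \<Rightarrow> bool" where
  "domain_set \<Omega> \<longleftrightarrow> \<Omega> \<noteq> {} \<and> open \<Omega> \<and> connected \<Omega>"

text \<open>The library's \<^const>\<open>diameter\<close> is real-valued and therefore carries no information for
  unbounded sets; here the diameter of an unbounded set is infinite.\<close>

definition ediam :: "'a::metric_space set \<Rightarrow> ennreal" where
  "ediam \<Omega> = (SUP x\<in>\<Omega>. SUP y\<in>\<Omega>. ennreal (dist x y))"

definition ball_dev :: "'a::euclidean_space set \<Rightarrow> ennreal" where
  "ball_dev \<Omega> = (SUP x\<in>\<Omega>. SUP r\<in>{r::real. 0 < r \<and> ennreal r \<le> ediam \<Omega>}.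
      emeasure lebesgue (ball x r) / emeasure lebesgue (ball x r \<inter> \<Omega>))"

definition diff_quot :: "real \<Rightarrow> ('a::real_normed_vector \<Rightarrow> real) \<Rightarrow> 'a \<Rightarrow> 'a \<Rightarrow> real" where
  "diff_quot b f x y = (if x = y then 0 else \<bar>f y - f x\<bar> / norm (y - x) powr (1 + b))"

definition level_set ::
  "'a::real_normed_vector set \<Rightarrow> real \<Rightarrow> real \<Rightarrow> ('a \<Rightarrow> real) \<Rightarrow> ('a \<times> 'a) set" where
  "level_set \<Omega> l b f = {(x, y). x \<in> \<Omega> \<and> y \<in> \<Omega> \<and> diff_quot b f x y > l}"

text \<open>The density takes the value 0 on the diagonal, because \<^term>\<open>0 powr a = (0::real)\<close>; the
  diagonal is a null set.\<close>

definition mu_meas ::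
  "(real ^ 'n) set \<Rightarrow> real \<Rightarrow> (real ^ 'n \<Rightarrow> real) \<Rightarrow> ((real ^ 'n) \<times> (real ^ 'n)) measure" where
  "mu_meas \<Omega> \<gamma> u = density (lebesgue_on \<Omega> \<Otimes>\<^sub>M lebesgue_on \<Omega>)
      (\<lambda>(x, y). ennreal (u x * norm (y - x) powr (\<gamma> - real CARD('n))))"

definition weight :: "'a::euclidean_space set \<Rightarrow> ('a \<Rightarrow> real) \<Rightarrow> bool" where
  "weight \<Omega> u \<longleftrightarrow> u \<in> borel_measurable (lebesgue_on \<Omega>) \<and> (\<forall>x\<in>\<Omega>. 0 \<le> u x)"

text \<open>On a null space (such as the empty set) the essential infimum is infinite.\<close>

definition essinf :: "'a measure \<Rightarrow> ('a \<Rightarrow> ennreal) \<Rightarrow> ennreal" where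
  "essinf M g = Sup {c. AE x in M. c \<le> g x}"

definition A1_bound ::
  "'a::euclidean_space set \<Rightarrow> ('a \<Rightarrow> real) \<Rightarrow> ('a \<Rightarrow> real) \<Rightarrow> ennreal \<Rightarrow> bool" where
  "A1_bound \<Omega> u w K \<longleftrightarrow> K < top \<and>
     (\<forall>c r. 0 < r \<longrightarrow>
        (\<integral>\<^sup>+x\<in>ball c r \<inter> \<Omega>. ennreal (u x) \<partial>lebesgue) / emeasure lebesgue (ball c r)
          \<le> K * essinf (lebesgue_on (ball c r \<inter> \<Omega>)) (\<lambda>y. ennreal (w y)))"

definition A1_pair :: "'a::euclidean_space set \<Rightarrow> ('a \<Rightarrow> real) \<Rightarrow> ('a \<Rightarrow> real) \<Rightarrow> bool" where
  "A1_pair \<Omega> u w \<longleftrightarrow> weight \<Omega> u \<and> weight \<Omega> w \<and> (\<exists>K. A1_bound \<Omega> u w K)"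

definition A1_const :: "'a::euclidean_space set \<Rightarrow> ('a \<Rightarrow> real) \<Rightarrow> ('a \<Rightarrow> real) \<Rightarrow> ennreal" where
  "A1_const \<Omega> u w = Inf {K. A1_bound \<Omega> u w K}"

definition maximal_fun :: "'a::euclidean_space set \<Rightarrow> ('a \<Rightarrow> real) \<Rightarrow> 'a \<Rightarrow> ennreal" where
  "maximal_fun \<Omega> u x = (SUP (c, r)\<in>{(c, r). 0 < r \<and> x \<in> ball c r}.
      (\<integral>\<^sup>+y\<in>ball c r \<inter> \<Omega>. ennreal \<bar>u y\<bar> \<partial>lebesgue) / emeasure lebesgue (ball c r))"

definition locally_integrable_on :: "('a::euclidean_space \<Rightarrow> real) \<Rightarrow> 'a set \<Rightarrow> bool"
    (infixr "locally'_integrable'_on" 46) where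
  "u locally_integrable_on \<Omega> \<longleftrightarrow>
     u \<in> borel_measurable (lebesgue_on \<Omega>) \<and>
     (\<forall>K. compact K \<and> K \<subseteq> \<Omega> \<longrightarrow> set_integrable lebesgue K u)"

definition gradient :: "('a::real_inner \<Rightarrow> real) \<Rightarrow> 'a \<Rightarrow> 'a" where
  "gradient f x = (THE D. GDERIV f x :> D)"

lemma gradient_eq:
  assumes "GDERIV f x :> D"
  shows "gradient f x = D"
  unfolding gradient_def
proof (rule the_equality)
  fix D' assume "GDERIV f x :> D'"
  with assms have "(\<lambda>h. inner h D') = (\<lambda>h. inner h D)"
    unfolding gderiv_def by (blast intro: has_derivative_unique)
  then have "inner (D' - D) D' = inner (D' - D) D" by metis
  then have "inner (D' - D) (D' - D) = 0" by (simp add: inner_diff_right)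
  then show "D' = D" by simp
qed (fact assms)

definition C1_on :: "'a::euclidean_space set \<Rightarrow> ('a \<Rightarrow> real) \<Rightarrow> bool" where
  "C1_on \<Omega> f \<longleftrightarrow> (\<forall>x\<in>\<Omega>. f differentiable (at x)) \<and> continuous_on \<Omega> (gradient f)"

end

theory Submission
  imports Defs
begin

text \<open>Put \<open>r = |x - y|\<close>, let \<open>D\<close> be the ball deviation and \<open>A q s\<close> the integral of \<open>|grad f|\<close> over the part
  of the ball \<open>B q s\<close> in \<open>\<Omega>\<close>. If the difference quotient at \<open>(x, y)\<close> exceeds \<open>l\<close>, then comparing \<open>f x\<close> and
  \<open>f y\<close> with the values \<open>f z\<close> for \<open>z\<close> in \<open>B x r\<close> and \<open>\<Omega>\<close> (a set of measure at least \<open>|B x r| / D\<close>) and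
  integrating along the segments from \<open>x\<close> and \<open>y\<close> to \<open>z\<close> shows that for one of the two points \<open>q\<close> and some
  \<open>0 < t \<le> 1\<close> the quantity \<open>A q (2 r t)\<close> is at least a constant times \<open>(l / D) r^(b + d) t^(d - 1/2)\<close>:
  otherwise the integrals over \<open>t\<close> of \<open>t^(-d) A q (2 r t)\<close> would be too small, \<open>t^(-1/2)\<close> being integrable.
  Splitting \<open>|grad f|\<close> at a suitable height \<open>\<kappa>\<close> turns this into a lower bound for the integral of
  \<open>|grad f|^p\<close> over the ball, with \<open>r^(\<gamma> + d)\<close> in place of \<open>r^(b + d)\<close>.

  For each dyadic scale of \<open>t\<close>, a Vitali selection among these balls leaves disjoint ones. The pairs
  \<open>(x, y)\<close> captured by a selected ball lie in shells \<open>|x - y| \<approx> \<rho>\<close> around it, on which the measure is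
  bounded by the \<open>u\<close>-mass of a larger ball, hence by the weight \<open>w\<close> (or the maximal function) on the
  selected ball itself. The series over the shells converges because \<open>\<gamma>\<close> is positive or less than \<open>-d\<close>,
  and the scales sum geometrically thanks to the exponent \<open>1/2\<close>.\<close>

section \<open>Vitali-type selection of disjoint balls\<close>

text \<open>Zorn's lemma takes the place of a greedy choice: members with small \<open>R\<close>
  have precedence, and since \<open>R\<close> is bounded below by a positive number, a minimiser up
  to the factor 2 exists. With the radius or its reciprocal as \<open>R\<close>, priority goes to
  small or to large balls.\<close>

lemma disjoint_subfamily:
  fixes B :: "'i \<Rightarrow> 'a set" and R :: "'i \<Rightarrow> real"
  assumes ne: "\<And>i. i \<in> K \<Longrightarrow> B i \<noteq> {}" and R: "\<And>i. i \<in> K \<Longrightarrow> \<delta> \<le> R i" and "0 < \<delta>"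
  shows "\<exists>C\<subseteq>K. disjoint_family_on B C \<and> (\<forall>i\<in>K. \<exists>j\<in>C. B i \<inter> B j \<noteq> {} \<and> R j \<le> 2 * R i)"
proof -
  \<comment> \<open>The size condition is imposed only on those \<open>i\<close> that meet
    \<open>C\<close>. Thus it holds for the empty family and passes to unions of chains; that every
    \<open>i\<close> meets \<open>C\<close> is left to maximality.\<close>
  define F where "F = {C. C \<subseteq> K \<and> disjoint_family_on B C \<and>
    (\<forall>i\<in>K. (\<exists>j\<in>C. B i \<inter> B j \<noteq> {}) \<longrightarrow> (\<exists>j\<in>C. B i \<inter> B j \<noteq> {} \<and> R j \<le> 2 * R i))}"
  have "{} \<in> F" by (auto simp: F_def disjoint_family_on_def)
  then have "F \<noteq> {}" by blast
  moreover have "\<Union>\<C> \<in> F" if "\<C> \<noteq> {}" "subset.chain F \<C>" for \<C>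
  proof -
    have sub: "\<And>C. C \<in> \<C> \<Longrightarrow> C \<in> F" using that by (auto simp: subset.chain_def)
    have "disjoint_family_on B (\<Union>\<C>)"
      unfolding disjoint_family_on_def
    proof (intro ballI impI)
      fix i j assume "i \<in> \<Union>\<C>" "j \<in> \<Union>\<C>" "i \<noteq> j"
      then obtain C D where CD: "C \<in> \<C>" "i \<in> C" "D \<in> \<C>" "j \<in> D" by blast
      then have "C \<subseteq> D \<or> D \<subseteq> C" using that by (auto simp: subset_chain_def)
      then obtain E where "E \<in> \<C>" "i \<in> E" "j \<in> E" using CD by blast
      then show "B i \<inter> B j = {}"
        using sub[of E] \<open>i \<noteq> j\<close> unfolding F_def disjoint_family_on_def by blast
    qed
    moreover have "\<exists>j\<in>\<Union>\<C>. B i \<inter> B j \<noteq> {} \<and> R j \<le> 2 * R i"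
      if ij: "i \<in> K" "j \<in> \<Union>\<C>" "B i \<inter> B j \<noteq> {}" for i j
    proof -
      obtain C where "C \<in> \<C>" "j \<in> C" using ij by blast
      then have "\<exists>j\<in>C. B i \<inter> B j \<noteq> {} \<and> R j \<le> 2 * R i"
        using sub[of C] ij unfolding F_def by blast
      then show ?thesis using \<open>C \<in> \<C>\<close> by blast
    qed
    moreover have "\<Union>\<C> \<subseteq> K" using sub unfolding F_def by blast
    ultimately show ?thesis unfolding F_def by blast
  qed
  ultimately obtain C where C: "C \<in> F" and max: "\<And>D. D \<in> F \<Longrightarrow> C \<subseteq> D \<Longrightarrow> D = C"
    using subset_Zorn_nonempty[of F] by blast
  have "\<exists>j\<in>C. B i \<inter> B j \<noteq> {}" if "i \<in> K" for i
  proof (rule ccontr)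
    txt \<open>A member of \<open>L\<close> with nearly minimal \<open>R\<close> could be added to the maximal family \<open>C\<close>.\<close>
    define L where "L = {i\<in>K. \<forall>j\<in>C. B i \<inter> B j = {}}"
    assume "\<not> (\<exists>j\<in>C. B i \<inter> B j \<noteq> {})"
    then have "i \<in> L" using that by (auto simp: L_def)
    have bdd: "bdd_below (R ` L)" using R by (auto simp: L_def intro!: bdd_belowI[of _ \<delta>])
    have "\<delta> \<le> Inf (R ` L)" using \<open>i \<in> L\<close> R by (intro cInf_greatest) (auto simp: L_def)
    then have "Inf (R ` L) < 2 * Inf (R ` L)" using \<open>0 < \<delta>\<close> by simp
    moreover have "R ` L \<noteq> {}" using \<open>i \<in> L\<close> by blast
    ultimately have "\<exists>r\<in>R ` L. r < 2 * Inf (R ` L)" by (rule cInf_lessD[rotated])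
    then obtain i0 where i0: "i0 \<in> L" "R i0 < 2 * Inf (R ` L)" by blast
    have i0_le: "R i0 \<le> 2 * R k" if "k \<in> L" for k
      using i0(2) cInf_lower[OF _ bdd, of "R k"] that by simp
    then have "insert i0 C \<in> F"
    proof -
      have "i0 \<in> K" "\<And>j. j \<in> C \<Longrightarrow> B i0 \<inter> B j = {}" using i0(1) by (auto simp: L_def)
      then have "disjoint_family_on B (insert i0 C)" "insert i0 C \<subseteq> K"
        using C unfolding F_def disjoint_family_on_def by auto
      moreover have "\<exists>j\<in>insert i0 C. B i \<inter> B j \<noteq> {} \<and> R j \<le> 2 * R i"
        if "i \<in> K" "\<exists>j\<in>insert i0 C. B i \<inter> B j \<noteq> {}" for i
      proof (cases "i \<in> L")
        case True
        moreover from True have "B i \<inter> B i0 \<noteq> {}" using that(2) by (auto simp: L_def)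
        ultimately show ?thesis using i0_le by blast
      next
        case False
        then show ?thesis using C \<open>i \<in> K\<close> unfolding F_def L_def by blast
      qed
      ultimately show ?thesis unfolding F_def by blast
    qed
    then have "i0 \<in> C" using max by blast
    \<comment> \<open>As a member of \<open>L\<close>, \<open>i0\<close> has a set disjoint from
      itself, hence empty.\<close>
    then show False using i0(1) ne unfolding L_def by blast
  qed
  then show ?thesis using C unfolding F_def by blast
qed

lemma dyadic_bracket_small:
  fixes x :: real
  assumes "0 < x" "x \<le> 2"
  shows "\<exists>j. 2 * (1/2) ^ j / 2 \<le> x \<and> x \<le> 2 * (1/2) ^ j"
proof -
  have ex: "\<exists>j. (1/2) ^ j \<le> x"
    using real_arch_pow_inv[OF assms(1), of "1/2"] by (auto intro: less_imp_le)
  define j where "j = (LEAST j. (1/2) ^ j \<le> x)"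
  have 1: "(1/2) ^ j \<le> x" unfolding j_def by (rule LeastI_ex[OF ex])
  have "x \<le> 2 * (1/2) ^ j"
  proof (cases j)
    case (Suc i)
    then have "\<not> (1/2) ^ i \<le> x" using not_less_Least[of i "\<lambda>j. (1/2) ^ j \<le> x"] by (simp add: j_def)
    then show ?thesis using Suc by simp
  qed (use assms in simp)
  then show ?thesis using 1 by auto
qed

lemma dyadic_bracket_large:
  fixes x :: real
  assumes "1 \<le> 2 * x"
  shows "\<exists>j. 2 ^ j / 2 \<le> x \<and> x \<le> 2 ^ j"
proof -
  have ex: "\<exists>j. x \<le> 2 ^ j" using real_arch_pow[of 2 x] by (auto intro: less_imp_le)
  define j where "j = (LEAST j. x \<le> 2 ^ j)"
  have 1: "x \<le> 2 ^ j" unfolding j_def by (rule LeastI_ex[OF ex])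
  have "2 ^ j / 2 \<le> x"
  proof (cases j)
    case (Suc i)
    then have "\<not> x \<le> 2 ^ i" using not_less_Least[of i "\<lambda>j. x \<le> 2 ^ j"] by (simp add: j_def)
    then show ?thesis using Suc by simp
  qed (use assms in simp)
  then show ?thesis using 1 by auto
qed

lemma power_powr_commute:
  fixes x a :: real
  assumes "0 < x"
  shows "(x ^ j) powr a = (x powr a) ^ j"
  using assms by (induction j) (simp_all add: powr_mult)

text \<open>For positive \<open>\<gamma>\<close> the large balls are selected first, for \<open>\<gamma> < -d\<close> the small ones: in
  either case the series over the dyadic ratios of radii converges.\<close>

lemma ball_selection:
  fixes \<gamma> :: real and d :: nat
  assumes "\<gamma> \<notin> {- real d..0}"
  shows "\<exists>\<sigma> \<alpha> :: nat \<Rightarrow> real. (\<forall>j. 0 < \<sigma> j \<and> 1 \<le> \<alpha> j) \<and> summable (\<lambda>j. \<sigma> j powr \<gamma> * \<alpha> j ^ d) \<and>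
    (\<forall>(K :: ('a::metric_space \<times> real) set) \<delta> M. 0 < \<delta> \<and> (\<forall>(z, s)\<in>K. \<delta> \<le> s \<and> s \<le> M) \<longrightarrow>
      (\<exists>C\<subseteq>K. disjoint_family_on (\<lambda>(c, t). ball c t) C \<and>
        (\<forall>(z, s)\<in>K. \<exists>(c, t)\<in>C. \<exists>j. \<sigma> j / 2 * t \<le> s \<and> s \<le> \<sigma> j * t \<and> dist z c < \<alpha> j * t)))"
proof (cases "0 < \<gamma>")
  case True
  \<comment> \<open>For positive \<open>\<gamma>\<close> the ratios \<open>s / t\<close> are at most
    2 and the enlargement is constantly 3, so the series is geometric of ratio
    \<open>(1/2) powr \<gamma>\<close>.\<close>
  have "(\<lambda>j. (2 * (1/2) ^ j) powr \<gamma> * 3 ^ d) = (\<lambda>j. 2 powr \<gamma> * 3 ^ d * ((1/2) powr \<gamma>) ^ j)"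
    by (simp add: powr_mult power_powr_commute mult.assoc mult.commute[of "3 ^ d"])
  moreover have "(1/2) powr \<gamma> < (1::real)" using powr_less_mono2[OF True, of "1/2" 1] by simp
  ultimately have sum: "summable (\<lambda>j. (2 * (1/2::real) ^ j) powr \<gamma> * 3 ^ d)"
    by (simp only:) (intro summable_mult summable_geometric, simp)
  have "\<exists>C\<subseteq>K. disjoint_family_on (\<lambda>(c, t). ball c t) C \<and> (\<forall>(z, s)\<in>K. \<exists>(c, t)\<in>C. \<exists>j.
      2 * (1/2) ^ j / 2 * t \<le> s \<and> s \<le> 2 * (1/2) ^ j * t \<and> dist z c < 3 * t)"
    if K: "0 < \<delta>" "\<forall>(z, s)\<in>K. \<delta> \<le> s \<and> s \<le> M" for K :: "('a \<times> real) set" and \<delta> M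
  proof -
    \<comment> \<open>With reciprocal radii as sizes, a selected ball of radius \<open>t\<close>
      meeting one of radius \<open>s\<close> satisfies \<open>s \<le> 2 * t\<close>. Using
      \<open>max 1 M\<close> gives a positive lower bound for the reciprocals whatever the sign of
      \<open>M\<close>.\<close>
    have "\<exists>C\<subseteq>K. disjoint_family_on (\<lambda>(c, t). ball c t) C \<and>
      (\<forall>i\<in>K. \<exists>j\<in>C. (\<lambda>(c, t). ball c t) i \<inter> (\<lambda>(c, t). ball c t) j \<noteq> {} \<and>
        1 / snd j \<le> 2 * (1 / snd i))"
    proof (rule disjoint_subfamily)
      show "0 < 1 / max 1 M" by simp
      show "1 / max 1 M \<le> 1 / snd i" if "i \<in> K" for i
        using K that by (intro divide_left_mono) auto
      show "(\<lambda>(c, t). ball c t) i \<noteq> {}" if "i \<in> K" for i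
        using K that by auto
    qed
    then obtain C where C: "C \<subseteq> K" "disjoint_family_on (\<lambda>(c, t). ball c t) C"
      and C_meet: "\<forall>i\<in>K. \<exists>j\<in>C. (\<lambda>(c, t). ball c t) i \<inter> (\<lambda>(c, t). ball c t) j \<noteq> {} \<and> 1 / snd j \<le> 2 * (1 / snd i)"
      by blast
    have meet: "\<exists>(c, t)\<in>C. ball z s \<inter> ball c t \<noteq> {} \<and> 1 / t \<le> 2 * (1 / s)" if "(z, s) \<in> K" for z s
      using bspec[OF C_meet that] by (simp add: split_beta)
    have "\<exists>(c, t)\<in>C. \<exists>j. 2 * (1/2) ^ j / 2 * t \<le> s \<and> s \<le> 2 * (1/2) ^ j * t \<and> dist z c < 3 * t"
      if zs: "(z, s) \<in> K" for z s
    proof -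
      obtain c t y where ct: "(c, t) \<in> C" and y: "dist z y < s" "dist c y < t"
        and le: "1 / t \<le> 2 * (1 / s)"
        using meet[OF zs] by auto
      have "0 < s" "0 < t" using K zs ct C by fastforce+
      then have st: "s \<le> 2 * t" using le by (simp add: field_simps)
      then obtain j :: nat where j: "2 * (1/2) ^ j / 2 \<le> s / t" "s / t \<le> 2 * (1/2) ^ j"
        using dyadic_bracket_small[of "s / t"] \<open>0 < s\<close> \<open>0 < t\<close> by (auto simp: field_simps)
      have "dist z c < 3 * t" using y st dist_triangle2[of z c y] by linarith
      with j ct show ?thesis
        using \<open>0 < t\<close> by (intro bexI[of _ "(c, t)"]) (auto simp: pos_le_divide_eq pos_divide_le_eq)
    qed
    then show ?thesis using C by auto
  qed
  then show ?thesis
    using sum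
    by (intro exI[where x = "\<lambda>j. 2 * (1/2) ^ j", OF exI[where x = "\<lambda>_. 3"]]) auto
next
  case False
  then have \<gamma>: "\<gamma> + real d < 0" using assms by auto
  \<comment> \<open>Now the selected balls may be much smaller than those they represent. The
    enlargement \<open>3 * 2 ^ j\<close> costs a factor \<open>2 ^ (j * d)\<close>, which the decay
    of \<open>2 powr (j * \<gamma>)\<close> compensates because
    \<open>\<gamma> + d < 0\<close>.\<close>
  have "(\<lambda>j. (2 ^ j) powr \<gamma> * (3 * 2 ^ j) ^ d) = (\<lambda>j. 3 ^ d * (2 powr (\<gamma> + real d)) ^ j)"
    by (simp add: power_powr_commute power_mult_distrib powr_add powr_realpow mult.left_commute
        mult.commute flip: power_mult)
  moreover have "2 powr (\<gamma> + real d) < (1::real)" using \<gamma> powr_less_mono[OF \<gamma>, of 2] by simp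
  ultimately have sum: "summable (\<lambda>j. (2 ^ j) powr \<gamma> * (3 * 2 ^ j :: real) ^ d)"
    by (simp only:) (intro summable_mult summable_geometric, simp)
  have "\<exists>C\<subseteq>K. disjoint_family_on (\<lambda>(c, t). ball c t) C \<and> (\<forall>(z, s)\<in>K. \<exists>(c, t)\<in>C. \<exists>j.
      2 ^ j / 2 * t \<le> s \<and> s \<le> 2 ^ j * t \<and> dist z c < 3 * 2 ^ j * t)"
    if K: "0 < \<delta>" "\<forall>(z, s)\<in>K. \<delta> \<le> s \<and> s \<le> M" for K :: "('a \<times> real) set" and \<delta> M
  proof -
    have "\<exists>C\<subseteq>K. disjoint_family_on (\<lambda>(c, t). ball c t) C \<and>
      (\<forall>i\<in>K. \<exists>j\<in>C. (\<lambda>(c, t). ball c t) i \<inter> (\<lambda>(c, t). ball c t) j \<noteq> {} \<and>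
        snd j \<le> 2 * snd i)"
    proof (rule disjoint_subfamily)
      show "0 < \<delta>" by fact
      show "\<delta> \<le> snd i" if "i \<in> K" for i
        using K that by auto
      show "(\<lambda>(c, t). ball c t) i \<noteq> {}" if "i \<in> K" for i
        using K that by auto
    qed
    then obtain C where C: "C \<subseteq> K" "disjoint_family_on (\<lambda>(c, t). ball c t) C"
      and C_meet: "\<forall>i\<in>K. \<exists>j\<in>C. (\<lambda>(c, t). ball c t) i \<inter> (\<lambda>(c, t). ball c t) j \<noteq> {} \<and> snd j \<le> 2 * snd i"
      by blast
    have meet: "\<exists>(c, t)\<in>C. ball z s \<inter> ball c t \<noteq> {} \<and> t \<le> 2 * s" if "(z, s) \<in> K" for z s
      using bspec[OF C_meet that] by (simp add: split_beta)
    have "\<exists>(c, t)\<in>C. \<exists>j. 2 ^ j / 2 * t \<le> s \<and> s \<le> 2 ^ j * t \<and> dist z c < 3 * 2 ^ j * t"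
      if zs: "(z, s) \<in> K" for z s
    proof -
      obtain c t y where ct: "(c, t) \<in> C" and y: "dist z y < s" "dist c y < t"
        and ts: "t \<le> 2 * s"
        using meet[OF zs] by auto
      have "0 < s" "0 < t" using K zs ct C by fastforce+
      then obtain j :: nat where j: "2 ^ j / 2 \<le> s / t" "s / t \<le> 2 ^ j"
        using dyadic_bracket_large[of "s / t"] ts by (auto simp: field_simps)
      then have st: "2 ^ j / 2 * t \<le> s" "s \<le> 2 ^ j * t"
        using \<open>0 < t\<close> by (auto simp: pos_le_divide_eq pos_divide_le_eq)
      have "t \<le> 2 ^ j * t" using \<open>0 < t\<close> by simp
      then have "dist z c < 3 * 2 ^ j * t"
        using y st ts dist_triangle2[of z c y] by linarith
      with st ct show ?thesis by (intro bexI[of _ "(c, t)"]) auto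
    qed
    then show ?thesis using C by auto
  qed
  moreover have "1 \<le> 3 * (2::real) ^ j" for j
    using one_le_power[of "2::real" j] by linarith
  ultimately show ?thesis
    using sum
    by (intro exI[where x = "\<lambda>j. 2 ^ j", OF exI[where x = "\<lambda>j. 3 * 2 ^ j"]]) auto
qed

section \<open>Measure of shells around a ball\<close>

definition volume_const :: "'a::euclidean_space itself \<Rightarrow> real" where
  "volume_const _ = unit_ball_vol (real DIM('a))"

lemma emeasure_lebesgue_ball:
  fixes c :: "'a::euclidean_space"
  assumes "0 \<le> r"
  shows "emeasure lebesgue (ball c r) = ennreal (volume_const TYPE('a) * r ^ DIM('a))"
  using assms by (simp add: emeasure_ball volume_const_def)

lemma volume_const_pos: "0 < volume_const TYPE('a::euclidean_space)"
  by (simp add: volume_const_def)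

text \<open>Common frame for the two inequalities: \<open>h\<close> will be the p-th power of the
  gradient norm, and \<open>W\<close> either the weight \<open>w\<close> times the A_1 constant or
  the maximal function of \<open>u\<close>. In \<open>majorant\<close> the exceptional null set may
  depend on the ball, which is all that an essential infimum yields.\<close>

locale weighted_domain =
  fixes \<Omega> :: "(real ^ 'n::finite) set" and u :: "real ^ 'n \<Rightarrow> real" and h W :: "real ^ 'n \<Rightarrow> ennreal"
  assumes open_domain: "open \<Omega>"
    and measurable_u: "u \<in> borel_measurable (lebesgue_on \<Omega>)"
    and measurable_h: "h \<in> borel_measurable (lebesgue_on \<Omega>)"
    and measurable_W: "W \<in> borel_measurable (lebesgue_on \<Omega>)"
    and majorant: "\<And>c r. 0 < r \<Longrightarrow> AE x in lebesgue_on \<Omega>. x \<in> ball c r \<longrightarrow>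
      (\<integral>\<^sup>+y. ennreal (u y) * indicator (ball c r) y \<partial>lebesgue_on \<Omega>)
        \<le> emeasure lebesgue (ball c r) * W x"
begin

abbreviation "M \<equiv> lebesgue_on \<Omega>"

definition mass :: "real ^ 'n \<Rightarrow> real \<Rightarrow> ennreal" where
  "mass c r = (\<integral>\<^sup>+x. ennreal (u x) * indicator (ball c r) x \<partial>M)"

definition energy :: "real ^ 'n \<Rightarrow> real \<Rightarrow> ennreal" where
  "energy c r = (\<integral>\<^sup>+x. h x * indicator (ball c r) x \<partial>M)"

definition weighted_energy :: "real ^ 'n \<Rightarrow> real \<Rightarrow> ennreal" where
  "weighted_energy c r = (\<integral>\<^sup>+x. h x * W x * indicator (ball c r) x \<partial>M)"

text \<open>Either coordinate may lie in the ball, because the large gradient integral may be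
  centred at \<open>x\<close> or at \<open>y\<close>. The factor 2 between the distance bounds
  matches the dyadic ratios in \<open>ball_selection\<close>.\<close>

definition shell :: "real ^ 'n \<Rightarrow> real \<Rightarrow> real \<Rightarrow> ((real ^ 'n) \<times> (real ^ 'n)) set" where
  "shell c a \<rho> = {(x, y). x \<in> \<Omega> \<and> y \<in> \<Omega> \<and> (x \<in> ball c a \<or> y \<in> ball c a) \<and>
     \<rho> / 2 \<le> norm (y - x) \<and> norm (y - x) \<le> \<rho>}"

lemmas [measurable] = measurable_u measurable_h measurable_W

lemma space_M: "space M = \<Omega>"
  by simp

lemma measurable_ident_M [measurable]: "(\<lambda>x. x) \<in> M \<rightarrow>\<^sub>M borel"
  by (intro measurable_restrict_space1) (auto simp: measurable_completion)

lemma measurable_indicator_M [measurable]: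
  "A \<in> sets borel \<Longrightarrow> (indicator A :: _ \<Rightarrow> ennreal) \<in> borel_measurable M"
  by (rule measurable_compose[OF measurable_ident_M]) simp

lemma sigma_finite_M: "sigma_finite_measure M"
proof (rule sigma_finite_measure_restrict_space)
  show "sigma_finite_measure (lebesgue :: (real ^ 'n) measure)"
  proof
    obtain A :: "(real ^ 'n) set set" where A: "countable A" "A \<subseteq> sets lborel" "\<Union>A = space lborel"
      "\<forall>a\<in>A. emeasure lborel a \<noteq> \<infinity>"
      using lborel.sigma_finite_countable by blast
    then have "A \<subseteq> sets lebesgue" "\<forall>a\<in>A. emeasure lebesgue a \<noteq> \<infinity>"
      by (auto simp: subset_iff)
    with A show "\<exists>A. countable A \<and> A \<subseteq> sets lebesgue \<and> \<Union>A = space (lebesgue :: (real ^ 'n) measure) \<and>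
        (\<forall>a\<in>A. emeasure lebesgue a \<noteq> \<infinity>)"
      by (intro exI[of _ A]) auto
  qed
qed (use open_domain in auto)

lemma emeasure_M_le: "A \<in> sets borel \<Longrightarrow> (\<integral>\<^sup>+y. indicator A y \<partial>M) \<le> emeasure lebesgue A"
proof -
  assume A: "A \<in> sets borel"
  have "(\<integral>\<^sup>+y. indicator A y \<partial>M) = (\<integral>\<^sup>+y. indicator A y * indicator \<Omega> y \<partial>lebesgue)"
    using open_domain by (intro nn_integral_restrict_space) auto
  also have "\<dots> \<le> (\<integral>\<^sup>+y. indicator A y \<partial>lebesgue)"
    by (intro nn_integral_mono) (auto split: split_indicator)
  also have "\<dots> = emeasure lebesgue A"
    using A by (intro nn_integral_indicator) auto
  finally show ?thesis .
qed

text \<open>The passage from \<open>u\<close> to \<open>W\<close>: the number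
  \<open>mass c r\<close> is bounded by the volume times \<open>W x\<close> at almost every
  \<open>x\<close> of the larger ball, hence of the smaller one, and this can be multiplied by
  \<open>h x\<close> and integrated there.\<close>

lemma mass_mult_energy_le:
  assumes "0 < r" "s \<le> r"
  shows "mass c r * energy c s \<le> emeasure lebesgue (ball c r) * weighted_energy c s"
proof -
  have "mass c r * energy c s = (\<integral>\<^sup>+x. mass c r * (h x * indicator (ball c s) x) \<partial>M)"
    unfolding energy_def by (simp add: nn_integral_cmult)
  also have "\<dots> \<le> (\<integral>\<^sup>+x. emeasure lebesgue (ball c r) * (h x * W x * indicator (ball c s) x) \<partial>M)"
  proof (rule nn_integral_mono_AE)
    show "AE x in M. mass c r * (h x * indicator (ball c s) x)
        \<le> emeasure lebesgue (ball c r) * (h x * W x * indicator (ball c s) x)"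
      using majorant[OF assms(1), of c]
    proof eventually_elim
      case (elim x)
      show ?case
      proof (cases "x \<in> ball c s")
        case True
        then have "mass c r \<le> emeasure lebesgue (ball c r) * W x"
          using elim assms by (auto simp: mass_def)
        then have "mass c r * h x \<le> emeasure lebesgue (ball c r) * W x * h x"
          by (rule mult_right_mono) simp
        then show ?thesis using True by (simp add: ac_simps)
      qed simp
    qed
  qed
  also have "\<dots> = emeasure lebesgue (ball c r) * weighted_energy c s"
    unfolding weighted_energy_def by (simp add: nn_integral_cmult)
  finally show ?thesis .
qed

lemma measurable_dist_M [measurable]: "(\<lambda>(x, y). norm (y - x)) \<in> borel_measurable (M \<Otimes>\<^sub>M M)"
proof -
  have [measurable]: "(\<lambda>z. fst z) \<in> M \<Otimes>\<^sub>M M \<rightarrow>\<^sub>M borel" "(\<lambda>z. snd z) \<in> M \<Otimes>\<^sub>M M \<rightarrow>\<^sub>M borel"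
    by (rule measurable_compose[OF measurable_fst measurable_ident_M]
             measurable_compose[OF measurable_snd measurable_ident_M])+
  show ?thesis by (simp add: split_beta)
qed

lemma sets_shell [measurable]: "shell c a \<rho> \<in> sets (M \<Otimes>\<^sub>M M)"
proof -
  have [measurable]: "(\<lambda>z. fst z) \<in> M \<Otimes>\<^sub>M M \<rightarrow>\<^sub>M borel" "(\<lambda>z. snd z) \<in> M \<Otimes>\<^sub>M M \<rightarrow>\<^sub>M borel"
    by (rule measurable_compose[OF measurable_fst measurable_ident_M]
             measurable_compose[OF measurable_snd measurable_ident_M])+
  have "shell c a \<rho> = {z \<in> space (M \<Otimes>\<^sub>M M). (dist c (fst z) < a \<or> dist c (snd z) < a) \<and>
      \<rho> / 2 \<le> norm (snd z - fst z) \<and> norm (snd z - fst z) \<le> \<rho>}"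
    by (auto simp: shell_def space_pair_measure space_M)
  also have "\<dots> \<in> sets (M \<Otimes>\<^sub>M M)" by measurable
  finally show ?thesis .
qed

lemma measurable_mu_density [measurable]:
  "(\<lambda>(x, y). ennreal (u x * norm (y - x) powr b)) \<in> borel_measurable (M \<Otimes>\<^sub>M M)"
  using measurable_dist_M by (simp add: split_beta)

text \<open>On the shell the kernel is comparable with \<open>\<rho> powr (\<gamma> - d)\<close>.
  The first summand counts the pairs with \<open>x\<close> in the ball, where \<open>y\<close> stays
  within \<open>2 * \<rho>\<close> of \<open>x\<close>. The second counts those with
  \<open>y\<close> in the ball: then \<open>x\<close> lies within \<open>a + 2 * \<rho>\<close> of
  \<open>c\<close>, and \<open>y\<close> in the intersection of two balls of radii \<open>a\<close>
  and \<open>2 * \<rho>\<close>.\<close>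

lemma emeasure_mu_meas_shell_le:
  fixes \<gamma> :: real
  defines "d \<equiv> CARD('n)"
  assumes "0 < a" "0 < \<rho>"
  shows "emeasure (mu_meas \<Omega> \<gamma> u) (shell c a \<rho>) \<le> ennreal (2 powr \<bar>\<gamma> - d\<bar> * \<rho> powr (\<gamma> - d)) *
    (mass c a * emeasure lebesgue (ball c (2 * \<rho>)) +
     mass c (a + 2 * \<rho>) * emeasure lebesgue (ball c (min a (2 * \<rho>))))"
proof -
  interpret sigma_finite_measure M by (rule sigma_finite_M)
  let ?k = "ennreal (2 powr \<bar>\<gamma> - d\<bar> * \<rho> powr (\<gamma> - d))"
  let ?f = "\<lambda>x. ennreal (u x) * (indicator (ball c a) x * emeasure lebesgue (ball c (2 * \<rho>)) +
       indicator (ball c (a + 2 * \<rho>)) x * emeasure lebesgue (ball c (min a (2 * \<rho>))))"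
  have kernel: "ennreal (u x * norm (y - x) powr (\<gamma> - d)) * indicator (shell c a \<rho>) (x, y)
      \<le> ?k * ennreal (u x) * (indicator (ball c a) x * indicator (ball x (2 * \<rho>)) y +
          indicator (ball c (a + 2 * \<rho>)) x * indicator (ball c a \<inter> ball x (2 * \<rho>)) y)" for x y
  proof (cases "(x, y) \<in> shell c a \<rho> \<and> 0 \<le> u x")
    case True
    then have *: "\<rho> / 2 \<le> norm (y - x)" "norm (y - x) \<le> \<rho>" "x \<in> ball c a \<or> y \<in> ball c a"
      by (auto simp: shell_def)
    have "norm (y - x) powr (\<gamma> - d) \<le> 2 powr \<bar>\<gamma> - d\<bar> * \<rho> powr (\<gamma> - d)"
    proof (cases "0 \<le> \<gamma> - d")
      case True
      have "norm (y - x) powr (\<gamma> - d) \<le> \<rho> powr (\<gamma> - d)" using * True by (intro powr_mono2) auto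
      also have "\<dots> \<le> 2 powr \<bar>\<gamma> - d\<bar> * \<rho> powr (\<gamma> - d)" 
        using mult_right_mono[of 1 "2 powr \<bar>\<gamma> - d\<bar>" "\<rho> powr (\<gamma> - d)"]
        by (simp add: ge_one_powr_ge_zero)
      finally show ?thesis .
    next
      case False
      have "norm (y - x) powr (\<gamma> - d) \<le> (\<rho> / 2) powr (\<gamma> - d)"
        using * False \<open>0 < \<rho>\<close> by (intro powr_mono2') auto
      also have "\<dots> = 2 powr \<bar>\<gamma> - d\<bar> * \<rho> powr (\<gamma> - d)"
      proof -
        have "\<bar>\<gamma> - d\<bar> = - (\<gamma> - d)" using False by simp
        then show ?thesis using \<open>0 < \<rho>\<close> by (simp only: powr_minus) (simp add: powr_divide field_simps)
      qed
      finally show ?thesis .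
    qed
    then have kernel_le: "ennreal (u x * norm (y - x) powr (\<gamma> - d)) \<le> ?k * ennreal (u x)"
      using True by (subst ennreal_mult'[symmetric]) (auto intro!: ennreal_leI mult_left_mono simp: mult.commute)
    \<comment> \<open>Doubling the radius turns the closed condition on the distance into membership
      in an open ball.\<close>
    have "dist x y < 2 * \<rho>" using *(2) \<open>0 < \<rho>\<close> by (simp add: dist_norm norm_minus_commute)
    moreover have "dist c x < a + 2 * \<rho>" if "dist c y < a"
      using that \<open>dist x y < 2 * \<rho>\<close> dist_triangle2[of c x y] by linarith
    ultimately have "1 \<le> (indicator (ball c a) x * indicator (ball x (2 * \<rho>)) y +
        indicator (ball c (a + 2 * \<rho>)) x * indicator (ball c a \<inter> ball x (2 * \<rho>)) y :: ennreal)"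
      using *(3) by (auto split: split_indicator)
    then have "?k * ennreal (u x) * 1 \<le> ?k * ennreal (u x) * (indicator (ball c a) x * indicator (ball x (2 * \<rho>)) y +
        indicator (ball c (a + 2 * \<rho>)) x * indicator (ball c a \<inter> ball x (2 * \<rho>)) y)"
      by (rule mult_left_mono) simp
    then show ?thesis
      using True kernel_le by (auto intro: order_trans)
  next
    \<comment> \<open>The left side vanishes: outside the shell by the indicator, and for negative
      \<open>u x\<close> because \<open>ennreal\<close> sends negative reals to 0.\<close>
    case False
    then show ?thesis by (auto simp: ennreal_neg mult_nonpos_nonneg split: split_indicator)
  qed
  have inner: "(\<integral>\<^sup>+y. ?k * ennreal (u x) * (indicator (ball c a) x * indicator (ball x (2 * \<rho>)) y +
      indicator (ball c (a + 2 * \<rho>)) x * indicator (ball c a \<inter> ball x (2 * \<rho>)) y) \<partial>M) \<le> ?k * ?f x" for x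
  proof -
    have min: "emeasure lebesgue (ball c a \<inter> ball x (2 * \<rho>)) \<le> emeasure lebesgue (ball c (min a (2 * \<rho>)))"
    proof (cases "a \<le> 2 * \<rho>")
      case True
      then show ?thesis by (auto simp: min_def intro!: emeasure_mono)
    next
      case False
      have "emeasure lebesgue (ball c a \<inter> ball x (2 * \<rho>)) \<le> emeasure lebesgue (ball x (2 * \<rho>))"
        by (auto intro!: emeasure_mono)
      also have "\<dots> = emeasure lebesgue (ball c (2 * \<rho>))"
        using \<open>0 < \<rho>\<close> by (simp add: emeasure_lebesgue_ball del: emeasure_completion)
      finally show ?thesis using False by (simp add: min_def)
    qed
    have 1: "(\<integral>\<^sup>+y. indicator (ball x (2 * \<rho>)) y \<partial>M) \<le> emeasure lebesgue (ball c (2 * \<rho>))"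
      using emeasure_M_le[of "ball x (2 * \<rho>)"] \<open>0 < \<rho>\<close>
      by (simp add: emeasure_lebesgue_ball del: emeasure_completion)
    have 2: "(\<integral>\<^sup>+y. indicator (ball c a \<inter> ball x (2 * \<rho>)) y \<partial>M)
        \<le> emeasure lebesgue (ball c (min a (2 * \<rho>)))"
      using emeasure_M_le[of "ball c a \<inter> ball x (2 * \<rho>)"] min by (meson borel_open open_Int open_ball order_trans)
    have "(\<integral>\<^sup>+y. ?k * ennreal (u x) * (indicator (ball c a) x * indicator (ball x (2 * \<rho>)) y +
      indicator (ball c (a + 2 * \<rho>)) x * indicator (ball c a \<inter> ball x (2 * \<rho>)) y) \<partial>M) =
      ?k * ennreal (u x) * (indicator (ball c a) x * (\<integral>\<^sup>+y. indicator (ball x (2 * \<rho>)) y \<partial>M) +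
      indicator (ball c (a + 2 * \<rho>)) x * (\<integral>\<^sup>+y. indicator (ball c a \<inter> ball x (2 * \<rho>)) y \<partial>M))"
      by (simp add: nn_integral_cmult nn_integral_add del: nn_integral_indicator nn_integral_indicator')
    also have "\<dots> \<le> ?k * ?f x"
      unfolding mult.assoc by (intro mult_left_mono add_mono 1 2) auto
    finally show ?thesis .
  qed
  have "emeasure (mu_meas \<Omega> \<gamma> u) (shell c a \<rho>) =
      (\<integral>\<^sup>+z. (case z of (x, y) \<Rightarrow> ennreal (u x * norm (y - x) powr (\<gamma> - d))) * indicator (shell c a \<rho>) z \<partial>(M \<Otimes>\<^sub>M M))"
    unfolding mu_meas_def d_def by (intro emeasure_density) measurable
  also have "\<dots> = (\<integral>\<^sup>+x. \<integral>\<^sup>+y. ennreal (u x * norm (y - x) powr (\<gamma> - d)) * indicator (shell c a \<rho>) (x, y) \<partial>M \<partial>M)"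
    by (subst nn_integral_fst[symmetric]) (auto intro!: borel_measurable_times_ennreal)
  also have "\<dots> \<le> (\<integral>\<^sup>+x. ?k * ?f x \<partial>M)"
    by (intro nn_integral_mono order_trans[OF nn_integral_mono[OF kernel] inner])
  also have "\<dots> = ?k * (mass c a * emeasure lebesgue (ball c (2 * \<rho>)) +
     mass c (a + 2 * \<rho>) * emeasure lebesgue (ball c (min a (2 * \<rho>))))"
  proof -
    have "(\<integral>\<^sup>+x. ?f x \<partial>M) = (\<integral>\<^sup>+x. ennreal (u x) * indicator (ball c a) x * emeasure lebesgue (ball c (2 * \<rho>)) +
       ennreal (u x) * indicator (ball c (a + 2 * \<rho>)) x * emeasure lebesgue (ball c (min a (2 * \<rho>))) \<partial>M)"
      by (simp only: distrib_left mult.assoc)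
    also have "\<dots> = mass c a * emeasure lebesgue (ball c (2 * \<rho>)) +
       mass c (a + 2 * \<rho>) * emeasure lebesgue (ball c (min a (2 * \<rho>)))"
      by (simp add: nn_integral_add nn_integral_multc mass_def del: emeasure_completion)
    finally show ?thesis by (simp add: nn_integral_cmult del: emeasure_completion)
  qed
  finally show ?thesis .
qed

text \<open>Multiplication by the energy of the inner ball lets \<open>mass_mult_energy_le\<close>
  replace both masses by volumes. These combine to a multiple of \<open>\<rho> ^ d * a ^ d\<close>,
  whichever of \<open>a\<close> and \<open>\<rho>\<close> is larger, and \<open>\<rho> ^ d\<close>
  turns the kernel bound into \<open>\<rho> powr \<gamma>\<close>.\<close>

lemma shell_estimate:
  fixes \<gamma> :: real
  defines "d \<equiv> CARD('n)"
  assumes "0 < a" "0 < \<rho>" "s \<le> a"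
  shows "emeasure (mu_meas \<Omega> \<gamma> u) (shell c a \<rho>) * energy c s \<le>
    ennreal (2 powr \<bar>\<gamma> - d\<bar> * (volume_const TYPE(real ^ 'n))\<^sup>2 * (2 ^ d + 4 ^ d) * \<rho> powr \<gamma> * a ^ d)
      * weighted_energy c s"
proof -
  define v where "v = volume_const TYPE(real ^ 'n)"
  define m where "m = min a (2 * \<rho>)"
  have "0 < v" by (simp add: v_def volume_const_pos)
  have "0 < m" using assms by (simp add: m_def)
  let ?k = "2 powr \<bar>\<gamma> - d\<bar> * \<rho> powr (\<gamma> - d)"
  have vol: "emeasure lebesgue (ball c r) = ennreal (v * r ^ d)" if "0 < r" for r
    using that by (simp add: emeasure_lebesgue_ball v_def d_def del: emeasure_completion)
  let ?V = "\<lambda>r. ennreal (v * r ^ d)"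
  \<comment> \<open>The minimum of two numbers times their sum is at most twice their product. For
    small \<open>\<rho>\<close> this relies on the minimum kept in the second volume.\<close>
  have "m * (a + 2 * \<rho>) \<le> 4 * a * \<rho>"
    using assms mult_left_mono[of a "2*\<rho>" a] mult_left_mono[of "2*\<rho>" a \<rho>]
    by (auto simp: m_def min_def algebra_simps)
  then have "(m * (a + 2 * \<rho>)) ^ d \<le> (4 * a * \<rho>) ^ d"
    using assms \<open>0 < m\<close> by (intro power_mono) auto
  then have m_le: "(a + 2 * \<rho>) ^ d * m ^ d \<le> 4 ^ d * a ^ d * \<rho> ^ d"
    by (simp add: power_mult_distrib mult.commute)
  have "emeasure (mu_meas \<Omega> \<gamma> u) (shell c a \<rho>) * energy c s \<le>
     ?k * (mass c a * ?V (2 * \<rho>) + mass c (a + 2 * \<rho>) * ?V m) * energy c s"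
    using emeasure_mu_meas_shell_le[of a \<rho> \<gamma> c] assms \<open>0 < m\<close>
    by (intro mult_right_mono) (simp_all add: vol d_def m_def del: emeasure_completion)
  also have "\<dots> = ?k * (?V (2 * \<rho>) * (mass c a * energy c s) + ?V m * (mass c (a + 2 * \<rho>) * energy c s))"
    by (simp add: algebra_simps)
  also have "\<dots> \<le> ?k * (?V (2 * \<rho>) * (?V a * weighted_energy c s) +
      ?V m * (?V (a + 2 * \<rho>) * weighted_energy c s))"
    using mass_mult_energy_le[of a s c] mass_mult_energy_le[of "a + 2 * \<rho>" s c] assms
    by (intro mult_left_mono add_mono) (simp_all add: vol del: emeasure_completion)
  also have "\<dots> = ennreal (?k * (v * (2 * \<rho>) ^ d * (v * a ^ d) + v * m ^ d * (v * (a + 2 * \<rho>) ^ d)))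
      * weighted_energy c s"
    using assms \<open>0 < v\<close> \<open>0 < m\<close>
    by (simp add: ennreal_mult' ennreal_plus distrib_left distrib_right mult.assoc)
  also have "\<dots> \<le> ennreal (2 powr \<bar>\<gamma> - d\<bar> * v\<^sup>2 * (2 ^ d + 4 ^ d) * \<rho> powr \<gamma> * a ^ d) * weighted_energy c s"
  proof (intro mult_right_mono ennreal_leI)
    have "v * (2 * \<rho>) ^ d * (v * a ^ d) + v * m ^ d * (v * (a + 2 * \<rho>) ^ d)
        = v\<^sup>2 * (2 ^ d * a ^ d * \<rho> ^ d + (a + 2 * \<rho>) ^ d * m ^ d)"
      by (simp add: algebra_simps power2_eq_square power_mult_distrib)
    also have "\<dots> \<le> v\<^sup>2 * (2 ^ d * a ^ d * \<rho> ^ d + 4 ^ d * a ^ d * \<rho> ^ d)"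
      using m_le by (intro mult_left_mono add_left_mono) auto
    finally have "?k * (v * (2 * \<rho>) ^ d * (v * a ^ d) + v * m ^ d * (v * (a + 2 * \<rho>) ^ d))
       \<le> ?k * (v\<^sup>2 * (2 ^ d * a ^ d * \<rho> ^ d + 4 ^ d * a ^ d * \<rho> ^ d))"
      by (rule mult_left_mono) simp
    also have "\<dots> = 2 powr \<bar>\<gamma> - d\<bar> * v\<^sup>2 * (2 ^ d + 4 ^ d) * (\<rho> powr (\<gamma> - d) * \<rho> ^ d) * a ^ d"
      by (simp add: algebra_simps)
    also have "\<rho> powr (\<gamma> - d) * \<rho> ^ d = \<rho> powr \<gamma>"
      using \<open>0 < \<rho>\<close> by (simp add: powr_realpow[symmetric] powr_add[symmetric])
    finally show "?k * (v * (2 * \<rho>) ^ d * (v * a ^ d) + v * m ^ d * (v * (a + 2 * \<rho>) ^ d))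
       \<le> 2 powr \<bar>\<gamma> - d\<bar> * v\<^sup>2 * (2 ^ d + 4 ^ d) * \<rho> powr \<gamma> * a ^ d" .
  qed simp
  finally show ?thesis by (simp add: v_def)
qed

end

section \<open>Oscillation of \<open>f\<close> and integrals of its gradient\<close>

text \<open>The vector with coordinates \<open>f' b\<close> represents the linear derivative as an
  inner product, so the definite description in \<open>gradient\<close> is attained.\<close>

lemma GDERIV_gradient:
  fixes f :: "'a::euclidean_space \<Rightarrow> real"
  assumes "f differentiable (at x)"
  shows "GDERIV f x :> gradient f x"
proof -
  obtain f' where f': "(f has_derivative f') (at x)"
    using assms by (auto simp: differentiable_def)
  define D where "D = (\<Sum>b\<in>Basis. f' b *\<^sub>R b)"
  have lin: "linear f'" using f' by (rule has_derivative_linear)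
  have "f' h = h \<bullet> D" for h
  proof -
    have "f' h = f' (\<Sum>b\<in>Basis. (h \<bullet> b) *\<^sub>R b)" by (simp add: euclidean_representation)
    also have "\<dots> = (\<Sum>b\<in>Basis. (h \<bullet> b) * f' b)"
      using lin by (simp add: linear_sum linear_cmul)
    also have "\<dots> = h \<bullet> D"
      by (simp add: D_def inner_sum_right mult.commute)
    finally show ?thesis .
  qed
  then have "f' = (\<lambda>h. h \<bullet> D)" by (rule ext)
  then have D: "GDERIV f x :> D" using f' by (simp add: gderiv_def)
  then show ?thesis by (simp only: gradient_eq[OF D])
qed

text \<open>Fundamental theorem of calculus along the segment, which convexity keeps inside
  \<open>\<Omega>\<close>, followed by Cauchy-Schwarz.\<close>

lemma diff_le_segment_integral:
  fixes f :: "'a::euclidean_space \<Rightarrow> real"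
  assumes \<Omega>: "convex \<Omega>" and f: "C1_on \<Omega> f" and q: "q \<in> \<Omega>" and z: "z \<in> \<Omega>"
  shows "ennreal \<bar>f z - f q\<bar> \<le> ennreal (norm (z - q)) *
    (\<integral>\<^sup>+t. ennreal (norm (gradient f (q + t *\<^sub>R (z - q)))) * indicator {0..1} t \<partial>lborel)"
proof -
  define \<sigma> where "\<sigma> t = q + t *\<^sub>R (z - q)" for t
  define g where "g t = norm (gradient f (\<sigma> t))" for t
  have \<sigma>_in: "\<sigma> t \<in> \<Omega>" if "t \<in> {0..1}" for t
  proof -
    have "(1 - t) *\<^sub>R q + t *\<^sub>R z \<in> \<Omega>" using that \<Omega> q z by (intro convexD) auto
    then show ?thesis by (simp add: \<sigma>_def algebra_simps)
  qed
  have cont_grad: "continuous_on {0..1} (\<lambda>t. gradient f (\<sigma> t))"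
  proof (rule continuous_on_compose2[of \<Omega> "gradient f"])
    show "continuous_on \<Omega> (gradient f)" using f by (simp add: C1_on_def)
    show "continuous_on {0..1} \<sigma>" unfolding \<sigma>_def by (intro continuous_intros)
    show "\<sigma> ` {0..1} \<subseteq> \<Omega>" using \<sigma>_in by blast
  qed
  have cont: "continuous_on {0..1} g"
    unfolding g_def by (intro continuous_intros cont_grad)
  have deriv: "((\<lambda>t. f (\<sigma> t)) has_vector_derivative (z - q) \<bullet> gradient f (\<sigma> t)) (at t within {0..1})"
    if "t \<in> {0..1}" for t
  proof -
    have "GDERIV f (\<sigma> t) :> gradient f (\<sigma> t)"
      using f \<sigma>_in[OF that] by (intro GDERIV_gradient) (auto simp: C1_on_def)
    then have 1: "(f has_derivative (\<lambda>h. h \<bullet> gradient f (\<sigma> t))) (at (\<sigma> t))"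
      by (simp add: gderiv_def)
    have 2: "(\<sigma> has_derivative (\<lambda>h. h *\<^sub>R (z - q))) (at t within {0..1})"
      unfolding \<sigma>_def by (auto intro!: derivative_eq_intros)
    show ?thesis
      using has_derivative_compose[OF 2 1] by (simp add: has_vector_derivative_def)
  qed
  have "((\<lambda>t. (z - q) \<bullet> gradient f (\<sigma> t)) has_integral f (\<sigma> 1) - f (\<sigma> 0)) {0..1}"
    by (rule fundamental_theorem_of_calculus[OF _ deriv]) auto
  then have int: "((\<lambda>t. (z - q) \<bullet> gradient f (\<sigma> t)) has_integral f z - f q) {0..1}"
    by (simp add: \<sigma>_def)
  have g_int: "g integrable_on {0..1}" by (rule integrable_continuous_real[OF cont])
  have "norm (f z - f q) \<le> integral {0..1} (\<lambda>t. norm (z - q) * g t)"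
    unfolding integral_unique[OF int, symmetric]
  proof (rule integral_norm_bound_integral)
    show "(\<lambda>t. (z - q) \<bullet> gradient f (\<sigma> t)) integrable_on {0..1}" using int by blast
    show "(\<lambda>t. norm (z - q) * g t) integrable_on {0..1}"
      using g_int by (rule integrable_on_mult_right)
    show "norm ((z - q) \<bullet> gradient f (\<sigma> t)) \<le> norm (z - q) * g t" for t
      by (simp add: g_def Cauchy_Schwarz_ineq2)
  qed
  then have le: "\<bar>f z - f q\<bar> \<le> norm (z - q) * integral {0..1} g" by simp
  have "(\<integral>\<^sup>+t. ennreal (g t) * indicator {0..1} t \<partial>lborel) = ennreal (integral {0..1} g)"
    by (rule nn_integral_has_integral_lebesgue'[OF _ integrable_integral[OF g_int]]) (simp add: g_def)
  moreover have "0 \<le> integral {0..1} g"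
    using g_int by (intro integral_nonneg) (auto simp: g_def)
  ultimately show ?thesis
    using le by (simp add: g_def \<sigma>_def ennreal_mult'[symmetric] ennreal_leI)
qed

text \<open>The homothety of centre \<open>q\<close> and ratio \<open>t\<close> maps
  \<open>ball q R\<close> onto \<open>ball q (t * R)\<close> with Jacobian \<open>t ^ d\<close>. It
  converts integrals along segments issuing from \<open>q\<close> into integrals over concentric
  balls.\<close>

lemma nn_integral_ball_homothety:
  fixes F :: "'a::euclidean_space \<Rightarrow> ennreal"
  assumes [measurable]: "F \<in> borel_measurable borel" and t: "0 < t"
  shows "(\<integral>\<^sup>+z. F (q + t *\<^sub>R (z - q)) * indicator (ball q R) z \<partial>lborel) =
    ennreal (1 / t ^ DIM('a)) * (\<integral>\<^sup>+z. F z * indicator (ball q (t * R)) z \<partial>lborel)"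
proof -
  define T where "T x = (q - t *\<^sub>R q) + t *\<^sub>R x" for x :: 'a
  have T_meas [measurable]: "T \<in> borel \<rightarrow>\<^sub>M borel" unfolding T_def by measurable
  have T: "T z = q + t *\<^sub>R (z - q)" for z by (simp add: T_def algebra_simps)
  have "dist q (T z) = t * dist q z" for z
    using t by (simp add: T dist_norm norm_minus_commute)
  then have ind: "indicator (ball q (t * R)) (T z) = (indicator (ball q R) z :: ennreal)" for z
    using t by (auto split: split_indicator)
  have "(\<integral>\<^sup>+z. F z * indicator (ball q (t * R)) z \<partial>lborel) =
      (\<integral>\<^sup>+z. F z * indicator (ball q (t * R)) z \<partial>density (distr lborel borel T) (\<lambda>_. ennreal (\<bar>t\<bar> ^ DIM('a))))"
    using lborel_affine[of t "q - t *\<^sub>R q"] t by (simp add: T_def[abs_def])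
  also have "\<dots> = (\<integral>\<^sup>+z. ennreal (\<bar>t\<bar> ^ DIM('a)) * (F z * indicator (ball q (t * R)) z) \<partial>distr lborel borel T)"
    by (rule nn_integral_density) (auto intro!: borel_measurable_times_ennreal borel_measurable_indicator)
  also have "\<dots> = (\<integral>\<^sup>+z. ennreal (\<bar>t\<bar> ^ DIM('a)) * (F (T z) * indicator (ball q (t * R)) (T z)) \<partial>lborel)"
    by (rule nn_integral_distr) (auto intro!: borel_measurable_times_ennreal borel_measurable_indicator)
  also have "\<dots> = ennreal (t ^ DIM('a)) * (\<integral>\<^sup>+z. F (T z) * indicator (ball q R) z \<partial>lborel)"
  proof -
    have "(\<lambda>z. F (T z) * indicator (ball q R) z) \<in> borel_measurable lborel"
      using measurable_compose[OF T_meas assms(1)]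
      by (auto intro!: borel_measurable_times_ennreal borel_measurable_indicator)
    then show ?thesis using t by (simp add: nn_integral_cmult ind)
  qed
  finally have "(\<integral>\<^sup>+z. F z * indicator (ball q (t * R)) z \<partial>lborel) =
      ennreal (t ^ DIM('a)) * (\<integral>\<^sup>+z. F (T z) * indicator (ball q R) z \<partial>lborel)" .
  moreover have "ennreal (1 / t ^ DIM('a)) * (ennreal (t ^ DIM('a)) * X) = X" for X
  proof -
    have "ennreal (1 / t ^ DIM('a)) * ennreal (t ^ DIM('a)) = ennreal (1 / t ^ DIM('a) * t ^ DIM('a))"
      using t by (intro ennreal_mult[symmetric]) auto
    also have "\<dots> = 1" using t by simp
    finally show ?thesis by (metis mult.assoc mult_1)
  qed
  ultimately show ?thesis by (simp only: T)
qed

lemma nn_integral_powr_minus_half: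
  "(\<integral>\<^sup>+t. ennreal (t powr (-1/2)) * indicator {0..1} t \<partial>lborel) = 2"
proof -
  have "((\<lambda>x::real. x powr (-1/2)) has_integral 2) {0..1}"
    using has_integral_powr_from_0[of "-1/2" 1] by simp
  then show ?thesis
    by (subst nn_integral_has_integral_lebesgue'[where I = 2]) auto
qed

text \<open>For \<open>p = 1\<close> this is \<open>A q s\<close> of the introduction. Integration
  against \<open>lborel\<close> over the whole space suits the affine substitution;
  \<open>gradient_integral_eq_lebesgue_on\<close> later identifies it with the energy of a
  ball.\<close>

definition gradient_integral :: "'a::euclidean_space set \<Rightarrow> ('a \<Rightarrow> real) \<Rightarrow> real \<Rightarrow> 'a \<Rightarrow> real \<Rightarrow> ennreal" where
  "gradient_integral \<Omega> f p q s =
     (\<integral>\<^sup>+z. ennreal (norm (gradient f z) powr p) * indicator (ball q s \<inter> \<Omega>) z \<partial>lborel)"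

lemma measurable_gradient_on:
  assumes "open \<Omega>" "C1_on \<Omega> f"
  shows "(\<lambda>z. ennreal (norm (gradient f z) powr p) * indicator \<Omega> z) \<in> borel_measurable borel"
proof -
  have "continuous_on \<Omega> (\<lambda>z. norm (gradient f z))"
    using assms by (auto simp: C1_on_def intro!: continuous_intros)
  then have "(\<lambda>z. indicator \<Omega> z *\<^sub>R norm (gradient f z)) \<in> borel_measurable borel"
    using assms by (intro borel_measurable_continuous_on_indicator) auto
  \<comment> \<open>The indicator also stands inside the power, because it is the norm cut off to
    \<open>\<Omega>\<close> that is known to be Borel.\<close>
  then have "(\<lambda>z. ennreal ((indicator \<Omega> z *\<^sub>R norm (gradient f z)) powr p) * indicator \<Omega> z) \<in> borel_measurable borel"
    using assms by (auto intro!: borel_measurable_times_ennreal borel_measurable_indicator)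
  also have "(\<lambda>z. ennreal ((indicator \<Omega> z *\<^sub>R norm (gradient f z)) powr p) * indicator \<Omega> z) =
      (\<lambda>z. ennreal (norm (gradient f z) powr p) * indicator \<Omega> z)"
    by (auto split: split_indicator)
  finally show ?thesis .
qed

text \<open>Integrating the segment bound over \<open>z\<close>, exchanging the integrals and
  applying the homothety at each \<open>t\<close> gives \<open>R\<close> times the integral of
  \<open>t^(-d)\<close> times the gradient integral over \<open>ball q (t * R)\<close>. By
  hypothesis the integrand is at most \<open>N * t^(-1/2)\<close>, whose integral over the unit
  interval is \<open>2 * N\<close>.\<close>

lemma oscillation_integral_le:
  fixes f :: "'a::euclidean_space \<Rightarrow> real"
  defines "d \<equiv> DIM('a)"
  assumes \<Omega>: "convex \<Omega>" "open \<Omega>" and f: "C1_on \<Omega> f" and q: "q \<in> \<Omega>" and "0 < R" "0 \<le> N"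
    and le: "\<And>t. 0 < t \<Longrightarrow> t \<le> 1 \<Longrightarrow> gradient_integral \<Omega> f 1 q (t * R) \<le> ennreal (N * t powr (d - 1/2))"
  shows "(\<integral>\<^sup>+z. ennreal \<bar>f z - f q\<bar> * indicator (ball q R \<inter> \<Omega>) z \<partial>lborel) \<le> ennreal (2 * R * N)"
proof -
  define G where "G z = ennreal (norm (gradient f z)) * indicator \<Omega> z" for z
  have [measurable]: "G \<in> borel_measurable borel"
    using measurable_gradient_on[OF \<Omega>(2) f, of 1] by (simp add: G_def[abs_def])
  have pointwise: "ennreal \<bar>f z - f q\<bar> * indicator (ball q R \<inter> \<Omega>) z \<le>
      (\<integral>\<^sup>+t. ennreal R * (G (q + t *\<^sub>R (z - q)) * indicator (ball q R) z * indicator {0..1} t) \<partial>lborel)" for z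
  proof (cases "z \<in> ball q R \<inter> \<Omega>")
    case True
    have "ennreal \<bar>f z - f q\<bar> \<le> ennreal (norm (z - q)) *
      (\<integral>\<^sup>+t. ennreal (norm (gradient f (q + t *\<^sub>R (z - q)))) * indicator {0..1} t \<partial>lborel)"
      using True by (intro diff_le_segment_integral[OF \<Omega>(1) f q]) auto
    \<comment> \<open>By convexity the segment stays in \<open>\<Omega>\<close>, so the cutoff
      contained in \<open>G\<close> changes nothing, while \<open>G\<close> is Borel on the whole
      space, as the exchange of integrals requires.\<close>
    also have "(\<integral>\<^sup>+t. ennreal (norm (gradient f (q + t *\<^sub>R (z - q)))) * indicator {0..1} t \<partial>lborel) =
      (\<integral>\<^sup>+t. G (q + t *\<^sub>R (z - q)) * indicator {0..1} t \<partial>lborel)"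
    proof (rule nn_integral_cong)
      fix t :: real
      have "q + t *\<^sub>R (z - q) \<in> \<Omega>" if "t \<in> {0..1}"
      proof -
        have "(1 - t) *\<^sub>R q + t *\<^sub>R z \<in> \<Omega>" using that \<Omega> q True by (intro convexD) auto
        then show ?thesis by (simp add: algebra_simps)
      qed
      then show "ennreal (norm (gradient f (q + t *\<^sub>R (z - q)))) * indicator {0..1} t =
          G (q + t *\<^sub>R (z - q)) * indicator {0..1} t"
        by (auto simp: G_def split: split_indicator)
    qed
    also have "ennreal (norm (z - q)) * \<dots> \<le> ennreal R * \<dots>"
      using True by (intro mult_right_mono ennreal_leI) (auto simp: dist_norm norm_minus_commute)
    also have "\<dots> = (\<integral>\<^sup>+t. ennreal R * (G (q + t *\<^sub>R (z - q)) * indicator (ball q R) z * indicator {0..1} t) \<partial>lborel)"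
      using True by (subst nn_integral_cmult[symmetric]) auto
    finally show ?thesis using True by simp
  qed simp
  have [measurable]: "(\<lambda>p. indicator (ball q R) (snd p) :: ennreal) \<in> borel_measurable (borel \<Otimes>\<^sub>M borel :: (real \<times> 'a) measure)"
    "(\<lambda>p. indicator {0..1} (fst p) :: ennreal) \<in> borel_measurable (borel \<Otimes>\<^sub>M borel :: (real \<times> 'a) measure)"
    by (auto intro: measurable_compose[OF measurable_snd borel_measurable_indicator]
        measurable_compose[OF measurable_fst borel_measurable_indicator])
  have pair: "pair_sigma_finite (lborel :: real measure) (lborel :: 'a measure)" ..
  have "(\<integral>\<^sup>+z. ennreal \<bar>f z - f q\<bar> * indicator (ball q R \<inter> \<Omega>) z \<partial>lborel) \<le>
      (\<integral>\<^sup>+z. \<integral>\<^sup>+t. ennreal R * (G (q + t *\<^sub>R (z - q)) * indicator (ball q R) z * indicator {0..1} t) \<partial>lborel \<partial>lborel)"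
    by (intro nn_integral_mono pointwise)
  also have "\<dots> = (\<integral>\<^sup>+t. \<integral>\<^sup>+z. ennreal R * (G (q + t *\<^sub>R (z - q)) * indicator (ball q R) z * indicator {0..1} t) \<partial>lborel \<partial>lborel)"
    by (rule pair_sigma_finite.Fubini[OF pair, of "\<lambda>(t, z). ennreal R * (G (q + t *\<^sub>R (z - q)) * indicator (ball q R) z * indicator {0..1} t)", simplified])
  also have "\<dots> \<le> (\<integral>\<^sup>+t. ennreal (R * N) * (ennreal (t powr (-1/2)) * indicator {0..1} t) \<partial>lborel)"
  proof (rule nn_integral_mono_AE)
    \<comment> \<open>At \<open>t = 0\<close> the homothety collapses the ball to a point, so this
      value is discarded.\<close>
    have "AE t in lborel. t \<noteq> (0::real)" by (rule AE_lborel_singleton)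
    then show "AE t in lborel. (\<integral>\<^sup>+z. ennreal R * (G (q + t *\<^sub>R (z - q)) * indicator (ball q R) z * indicator {0..1} t) \<partial>lborel)
        \<le> ennreal (R * N) * (ennreal (t powr (-1/2)) * indicator {0..1} t)"
    proof eventually_elim
      case (elim t)
      show ?case
      proof (cases "t \<in> {0..1}")
        case True
        then have t: "0 < t" "t \<le> 1" using elim by auto
        have "(\<integral>\<^sup>+z. ennreal R * (G (q + t *\<^sub>R (z - q)) * indicator (ball q R) z * indicator {0..1} t) \<partial>lborel) =
            ennreal R * (\<integral>\<^sup>+z. G (q + t *\<^sub>R (z - q)) * indicator (ball q R) z \<partial>lborel)"
        proof -
          have "(\<lambda>z. G (q + t *\<^sub>R (z - q)) * indicator (ball q R) z) \<in> borel_measurable lborel"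
            by (auto intro!: borel_measurable_times_ennreal borel_measurable_indicator
                measurable_compose[OF _ \<open>G \<in> borel_measurable borel\<close>])
          then show ?thesis using True by (simp add: nn_integral_cmult)
        qed
        also have "\<dots> = ennreal R * (ennreal (1 / t ^ d) * (\<integral>\<^sup>+z. G z * indicator (ball q (t * R)) z \<partial>lborel))"
          using nn_integral_ball_homothety[OF \<open>G \<in> borel_measurable borel\<close> t(1), of q R]
          by (simp only: d_def)
        also have "(\<integral>\<^sup>+z. G z * indicator (ball q (t * R)) z \<partial>lborel) = gradient_integral \<Omega> f 1 q (t * R)"
          unfolding gradient_integral_def G_def by (intro nn_integral_cong) (auto split: split_indicator)
        also have "ennreal R * (ennreal (1 / t ^ d) * \<dots>) \<le>
            ennreal R * (ennreal (1 / t ^ d) * ennreal (N * t powr (d - 1/2)))"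
          using t by (intro mult_left_mono le) auto
        also have "\<dots> = ennreal (R * N * t powr (-1/2))"
        proof -
          have "t powr (d - 1/2) = t ^ d * t powr (-1/2)"
            using powr_add[of t "real d" "-1/2"] t by (simp add: powr_realpow)
          then have "1 / t ^ d * (N * t powr (d - 1/2)) = N * t powr (-1/2)" using t by simp
          moreover have "ennreal (R * (a * b)) = ennreal R * (ennreal a * ennreal b)" if "0 \<le> a" "0 \<le> b" for a b
            using that \<open>0 < R\<close> by (simp add: ennreal_mult)
          from this[of "1 / t ^ d" "N * t powr (d - 1/2)"]
          have "ennreal R * (ennreal (1 / t ^ d) * ennreal (N * t powr (d - 1/2))) =
              ennreal (R * (1 / t ^ d * (N * t powr (d - 1/2))))"
            using t \<open>0 \<le> N\<close> by auto
          ultimately show ?thesis by (simp only: mult.assoc)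
        qed
        also have "\<dots> = ennreal (R * N) * ennreal (t powr (-1/2))"
          using \<open>0 < R\<close> \<open>0 \<le> N\<close> by (intro ennreal_mult) auto
        finally show ?thesis using True by simp
      qed simp
    qed
  qed
  also have "\<dots> = ennreal (R * N) * 2"
  proof -
    have "(\<lambda>t. ennreal (t powr (-1/2)) * indicator {0..1} t) \<in> borel_measurable (lborel :: real measure)"
      by (auto intro!: borel_measurable_times_ennreal borel_measurable_indicator)
    then show ?thesis by (simp only: nn_integral_cmult nn_integral_powr_minus_half)
  qed
  also have "\<dots> = ennreal (2 * R * N)"
  proof -
    have "ennreal (R * N * 2) = ennreal (R * N) * ennreal 2"
      using \<open>0 < R\<close> \<open>0 \<le> N\<close> by (intro ennreal_mult) auto
    moreover have "R * N * 2 = 2 * R * N" by simp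
    ultimately show ?thesis by (metis ennreal_numeral)
  qed
  finally show ?thesis .
qed

section \<open>Lower bounds for gradient integrals on the level set\<close>

lemma ennreal_divide_le_imp_le_mult:
  fixes a b c :: ennreal
  assumes "a / b \<le> c" "b \<noteq> 0" "b \<noteq> top"
  shows "a \<le> b * c"
proof -
  have "a = a / b * b" using assms by (simp add: ennreal_divide_times ennreal_divide_self less_top)
  also have "\<dots> \<le> c * b" using assms(1) by (rule mult_right_mono) simp
  finally show ?thesis by (simp add: mult.commute)
qed

text \<open>The distance of two points of \<open>\<Omega>\<close> is at most the diameter, hence an
  admissible radius in the supremum.\<close>

lemma ball_dev_bound:
  fixes \<Omega> :: "'a::euclidean_space set"
  assumes "open \<Omega>" "ball_dev \<Omega> < top" "x \<in> \<Omega>" "y \<in> \<Omega>" "x \<noteq> y"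
  defines "r \<equiv> dist x y"
  shows "emeasure lborel (ball x r) \<le> ball_dev \<Omega> * emeasure lborel (ball x r \<inter> \<Omega>)"
proof -
  have r: "0 < r" using assms by (simp add: r_def)
  have "ennreal r \<le> ediam \<Omega>"
    unfolding ediam_def r_def using assms by (intro SUP_upper2[of x] SUP_upper2[of y]) auto
  then have "emeasure lebesgue (ball x r) / emeasure lebesgue (ball x r \<inter> \<Omega>) \<le> ball_dev \<Omega>"
    unfolding ball_dev_def using assms(3) r by (intro SUP_upper2[of x] SUP_upper2[of r]) auto
  moreover have "ball x r \<inter> \<Omega> \<in> sets borel" using assms by auto
  ultimately have le: "emeasure lborel (ball x r) / emeasure lborel (ball x r \<inter> \<Omega>) \<le> ball_dev \<Omega>"
    by simp
  have "0 < emeasure lborel (ball x r)"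
    using r by (simp add: emeasure_ball)
  \<comment> \<open>A positive number divided by 0 is \<open>top\<close> in \<open>ennreal\<close>,
    which would make the deviation infinite.\<close>
  then have nz: "emeasure lborel (ball x r \<inter> \<Omega>) \<noteq> 0"
    using le assms(2) by (auto simp: divide_ennreal_def ennreal_mult_top top_unique split: if_splits)
  have nt: "emeasure lborel (ball x r \<inter> \<Omega>) \<noteq> top"
    using emeasure_bounded_finite[of "ball x r \<inter> \<Omega>"] bounded_ball[of x r]
    by (metis Int_lower1 bounded_subset infinity_ennreal_def less_irrefl)
  show ?thesis
    using ennreal_divide_le_imp_le_mult[OF le nz nt] by (simp only: mult.commute)
qed

text \<open>Suppose the bound fails at both points. On the balls of radius \<open>2 * r\<close>,
  which contain \<open>ball x r\<close>, \<open>oscillation_integral_le\<close> bounds each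
  oscillation integral by \<open>4 * r * N\<close>. Integrating the triangle inequality through
  \<open>f z\<close> over the part of \<open>ball x r\<close> in \<open>\<Omega>\<close> bounds
  \<open>\<bar>f y - f x\<bar>\<close> times the measure of that part by \<open>8 * r * N\<close>;
  the 8 in \<open>N\<close> makes this contradict the level set condition. The second conclusion
  serves later divisions by the deviation.\<close>

lemma large_gradient_integral:
  fixes f :: "'a::euclidean_space \<Rightarrow> real"
  defines "d \<equiv> DIM('a)"
  assumes \<Omega>: "convex \<Omega>" "open \<Omega>" and dev: "ball_dev \<Omega> < top" and f: "C1_on \<Omega> f"
    and "0 < l" and xy: "(x, y) \<in> level_set \<Omega> l b f"
  defines "r \<equiv> dist x y"
    and "N \<equiv> l * volume_const TYPE('a) * dist x y powr (b + d) / (8 * enn2real (ball_dev \<Omega>))"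
  shows "\<exists>q\<in>{x, y}. \<exists>t. 0 < t \<and> t \<le> 1 \<and>
    ennreal (N * t powr (d - 1/2)) < gradient_integral \<Omega> f 1 q (t * (2 * r))"
    and "0 < enn2real (ball_dev \<Omega>)"
proof -
  define v where "v = volume_const TYPE('a)"
  define D where "D = enn2real (ball_dev \<Omega>)"
  define \<beta> where "\<beta> = measure lborel (ball x r \<inter> \<Omega>)"
  have x: "x \<in> \<Omega>" and y: "y \<in> \<Omega>" and quot: "l < diff_quot b f x y"
    using xy by (auto simp: level_set_def)
  have ne: "x \<noteq> y" using quot \<open>0 < l\<close> by (auto simp: diff_quot_def)
  then have r: "0 < r" by (simp add: r_def)
  have "0 < v" by (simp add: v_def volume_const_pos)
  have quot': "l * r powr (1 + b) < \<bar>f y - f x\<bar>"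
    using quot ne r by (simp add: diff_quot_def r_def dist_norm norm_minus_commute pos_less_divide_eq)
  have dev_eq: "ball_dev \<Omega> = ennreal D" using dev by (simp add: D_def)
  have "emeasure lborel (ball x r \<inter> \<Omega>) < top"
    using emeasure_bounded_finite[of "ball x r \<inter> \<Omega>"] bounded_subset[OF bounded_ball[of x r], of "ball x r \<inter> \<Omega>"]
    by simp
  then have \<beta>_eq: "emeasure lborel (ball x r \<inter> \<Omega>) = ennreal \<beta>"
    by (simp add: \<beta>_def emeasure_eq_ennreal_measure)
  have "ennreal (v * r ^ d) \<le> ennreal D * ennreal \<beta>"
    using ball_dev_bound[OF \<Omega>(2) dev x y ne] r
    by (simp add: r_def[symmetric] dev_eq \<beta>_eq emeasure_ball v_def volume_const_def d_def)
  then have "ennreal (v * r ^ d) \<le> ennreal (D * \<beta>)"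
    by (simp add: ennreal_mult' D_def)
  then have vol: "v * r ^ d \<le> D * \<beta>"
    by (rule ennreal_le_iff[THEN iffD1, rotated]) (simp add: D_def \<beta>_def)
  have "0 < v * r ^ d" using r \<open>0 < v\<close> by simp
  with vol have "0 < D * \<beta>" by linarith
  then show D: "0 < enn2real (ball_dev \<Omega>)"
    using enn2real_nonneg[of "ball_dev \<Omega>"] by (auto simp: zero_less_mult_iff D_def)
  show "\<exists>q\<in>{x, y}. \<exists>t. 0 < t \<and> t \<le> 1 \<and>
    ennreal (N * t powr (d - 1/2)) < gradient_integral \<Omega> f 1 q (t * (2 * r))"
  proof (rule ccontr)
    assume *: "\<not> ?thesis"
    have N: "0 \<le> N" using \<open>0 < l\<close> \<open>0 < v\<close> D by (simp add: N_def v_def[symmetric] D_def)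
    have le: "gradient_integral \<Omega> f 1 q (t * (2 * r)) \<le> ennreal (N * t powr (d - 1/2))"
      if "q \<in> {x, y}" "0 < t" "t \<le> 1" for q t
      using * that by (meson not_le)
    define I where "I q z = ennreal \<bar>f z - f q\<bar> * indicator (ball q (2 * r) \<inter> \<Omega>) z" for q z
    have I_le: "(\<integral>\<^sup>+z. I q z \<partial>lborel) \<le> ennreal (4 * r * N)" if "q \<in> {x, y}" for q
    proof -
      have "(\<integral>\<^sup>+z. I q z \<partial>lborel) \<le> ennreal (2 * (2 * r) * N)"
        unfolding I_def using le[OF that] that x y r N
        by (intro oscillation_integral_le \<Omega> f) (auto simp: d_def)
      then show ?thesis by simp
    qed
    have cont: "continuous_on \<Omega> f"
      using f by (auto simp: C1_on_def intro!: differentiable_imp_continuous_on differentiable_at_imp_differentiable_on)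
    have I_meas: "I q \<in> borel_measurable lborel" for q
    proof -
      have "(\<lambda>z. indicator (ball q (2 * r) \<inter> \<Omega>) z *\<^sub>R \<bar>f z - f q\<bar>) \<in> borel_measurable borel"
        using \<Omega> by (intro borel_measurable_continuous_on_indicator continuous_intros
            continuous_on_subset[OF cont]) auto
      then have "(\<lambda>z. ennreal (indicator (ball q (2 * r) \<inter> \<Omega>) z *\<^sub>R \<bar>f z - f q\<bar>)) \<in> borel_measurable borel"
        by (rule measurable_compose) simp
      also have "(\<lambda>z. ennreal (indicator (ball q (2 * r) \<inter> \<Omega>) z *\<^sub>R \<bar>f z - f q\<bar>)) = I q"
        by (auto simp: I_def fun_eq_iff split: split_indicator)
      finally show ?thesis by simp
    qed
    have "ennreal (\<bar>f y - f x\<bar> * \<beta>) = (\<integral>\<^sup>+z. ennreal \<bar>f y - f x\<bar> * indicator (ball x r \<inter> \<Omega>) z \<partial>lborel)"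
      using \<Omega> by (subst nn_integral_cmult_indicator) (auto simp: \<beta>_eq ennreal_mult')
    also have "\<dots> \<le> (\<integral>\<^sup>+z. I x z + I y z \<partial>lborel)"
    proof (rule nn_integral_mono)
      fix z
      show "ennreal \<bar>f y - f x\<bar> * indicator (ball x r \<inter> \<Omega>) z \<le> I x z + I y z"
      proof (cases "z \<in> ball x r \<inter> \<Omega>")
        case True
        then have "dist x z < r" by simp
        moreover have "dist y z \<le> r + dist x z"
          using dist_triangle[of y z x] by (simp add: r_def dist_commute)
        ultimately have "dist y z < 2 * r" "dist x z < 2 * r" using r by linarith+
        moreover have "ennreal \<bar>f y - f x\<bar> \<le> ennreal \<bar>f z - f x\<bar> + ennreal \<bar>f z - f y\<bar>"
        proof -
          have "\<bar>f y - f x\<bar> \<le> \<bar>f z - f x\<bar> + \<bar>f z - f y\<bar>" by linarith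
          then have "ennreal \<bar>f y - f x\<bar> \<le> ennreal (\<bar>f z - f x\<bar> + \<bar>f z - f y\<bar>)" by (rule ennreal_leI)
          then show ?thesis by simp
        qed
        ultimately show ?thesis using True by (simp add: I_def)
      qed simp
    qed
    also have "\<dots> = (\<integral>\<^sup>+z. I x z \<partial>lborel) + (\<integral>\<^sup>+z. I y z \<partial>lborel)"
      by (intro nn_integral_add I_meas)
    also have "\<dots> \<le> ennreal (4 * r * N) + ennreal (4 * r * N)"
      by (intro add_mono I_le) auto
    also have "\<dots> = ennreal (8 * r * N)"
      using r N by (subst ennreal_plus[symmetric]) auto
    finally have "\<bar>f y - f x\<bar> * \<beta> \<le> 8 * r * N"
      using r N by (subst (asm) ennreal_le_iff) auto
    also have "8 * r * N = l * v * (r * r powr (b + d)) / D"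
      using D by (simp add: N_def v_def D_def r_def)
    also have "r * r powr (b + d) = r powr (1 + b) * r ^ d"
      using r by (simp add: powr_add powr_realpow mult.assoc)
    finally have upper: "\<bar>f y - f x\<bar> * \<beta> \<le> l * v * (r powr (1 + b) * r ^ d) / D" .
    have Dpos: "0 < D" using D by (simp add: D_def)
    then have "0 < \<beta>" using \<open>0 < D * \<beta>\<close> by (simp add: zero_less_mult_iff)
    \<comment> \<open>The volume bound \<open>v * r ^ d \<le> D * \<beta>\<close> absorbs the
      deviation built into \<open>N\<close>; what remains contradicts the strict inequality
      \<open>quot'\<close>.\<close>
    have "l * v * (r powr (1 + b) * r ^ d) / D = l * r powr (1 + b) * (v * r ^ d) / D" by simp
    also have "\<dots> \<le> l * r powr (1 + b) * (D * \<beta>) / D"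
      using vol \<open>0 < l\<close> Dpos by (intro divide_right_mono mult_left_mono) auto
    also have "\<dots> = l * r powr (1 + b) * \<beta>" using Dpos by simp
    also have "\<dots> < \<bar>f y - f x\<bar> * \<beta>" using quot' \<open>0 < \<beta>\<close> by (rule mult_strict_right_mono)
    finally show False using upper by linarith
  qed
qed

text \<open>Above the height \<open>\<kappa>\<close> the factor
  \<open>(g / \<kappa>) powr (p - 1)\<close> is at least 1; below it the first summand
  suffices.\<close>

lemma le_add_powr:
  fixes g \<kappa> p :: real
  assumes "0 \<le> g" "0 < \<kappa>" "1 \<le> p"
  shows "g \<le> \<kappa> + \<kappa> powr (1 - p) * g powr p"
proof (cases "g \<le> \<kappa>")
  case True
  then show ?thesis by (smt (verit) mult_nonneg_nonneg powr_ge_zero)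
next
  case False
  have "g = g powr (1 - p) * g powr p"
    using assms False by (simp add: powr_add[symmetric])
  also have "\<dots> \<le> \<kappa> powr (1 - p) * g powr p"
    using assms False by (intro mult_right_mono powr_mono2') auto
  finally show ?thesis using assms by linarith
qed

text \<open>Integrated form of \<open>le_add_powr\<close>; the free height \<open>\<kappa>\<close>,
  fixed only later, takes the place of Hoelder's inequality.\<close>

lemma gradient_integral_powr:
  fixes f :: "'a::euclidean_space \<Rightarrow> real"
  defines "d \<equiv> DIM('a)"
  assumes \<Omega>: "open \<Omega>" and f: "C1_on \<Omega> f" and "0 < \<kappa>" "1 \<le> p" "0 \<le> s"
  shows "gradient_integral \<Omega> f 1 q s \<le>
    ennreal (\<kappa> * (volume_const TYPE('a) * s ^ d)) + ennreal (\<kappa> powr (1 - p)) * gradient_integral \<Omega> f p q s"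
proof -
  have meas: "(\<lambda>z. ennreal (norm (gradient f z) powr p) * indicator (ball q s \<inter> \<Omega>) z) \<in> borel_measurable lborel"
  proof -
    have "(\<lambda>z. ennreal (norm (gradient f z) powr p) * indicator \<Omega> z * indicator (ball q s) z) \<in> borel_measurable borel"
      by (rule borel_measurable_times_ennreal[OF measurable_gradient_on[OF \<Omega> f] borel_measurable_indicator]) auto
    then show ?thesis by (simp add: indicator_inter_arith mult_ac)
  qed
  have "gradient_integral \<Omega> f 1 q s \<le> (\<integral>\<^sup>+z. ennreal \<kappa> * indicator (ball q s) z +
      ennreal (\<kappa> powr (1 - p)) * (ennreal (norm (gradient f z) powr p) * indicator (ball q s \<inter> \<Omega>) z) \<partial>lborel)"
    unfolding gradient_integral_def
  proof (rule nn_integral_mono)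
    fix z
    have "ennreal (norm (gradient f z)) \<le> ennreal (\<kappa> + \<kappa> powr (1 - p) * norm (gradient f z) powr p)"
      using assms by (intro ennreal_leI le_add_powr) auto
    also have "\<dots> = ennreal \<kappa> + ennreal (\<kappa> powr (1 - p)) * ennreal (norm (gradient f z) powr p)"
      using \<open>0 < \<kappa>\<close> by (simp add: ennreal_plus ennreal_mult')
    finally show "ennreal (norm (gradient f z) powr 1) * indicator (ball q s \<inter> \<Omega>) z \<le> ennreal \<kappa> * indicator (ball q s) z +
      ennreal (\<kappa> powr (1 - p)) * (ennreal (norm (gradient f z) powr p) * indicator (ball q s \<inter> \<Omega>) z)"
      by (auto split: split_indicator)
  qed
  also have "\<dots> = ennreal \<kappa> * emeasure lborel (ball q s) + ennreal (\<kappa> powr (1 - p)) * gradient_integral \<Omega> f p q s"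
    unfolding gradient_integral_def
    using meas by (subst nn_integral_add) (auto simp: nn_integral_cmult nn_integral_cmult_indicator intro!: borel_measurable_times_ennreal borel_measurable_indicator)
  also have "ennreal \<kappa> * emeasure lborel (ball q s) = ennreal (\<kappa> * (volume_const TYPE('a) * s ^ d))"
    using assms by (simp add: emeasure_ball volume_const_def d_def ennreal_mult')
  finally show ?thesis .
qed

text \<open>Half of the lower bound for \<open>p = 1\<close> survives the splitting at
  \<open>\<kappa>\<close>, and multiplication by \<open>\<kappa> powr (p - 1)\<close> isolates the
  integral of the p-th power. In the constant, 16 is the 8 of \<open>N\<close> doubled by the
  halving, \<open>2 powr ((d + 4) * (p - 1))\<close> comes from \<open>\<kappa>\<close>, and
  \<open>2 ^ d\<close> from rounding \<open>t\<close> up to a power of one half, which leaves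
  countably many scales.\<close>

lemma large_powr_gradient_integral:
  fixes f :: "'a::euclidean_space \<Rightarrow> real"
  defines "d \<equiv> DIM('a)"
  assumes \<Omega>: "convex \<Omega>" "open \<Omega>" and dev: "ball_dev \<Omega> < top" and f: "C1_on \<Omega> f"
    and "0 < l" and xy: "(x, y) \<in> level_set \<Omega> l b f" and "1 \<le> p"
  defines "r \<equiv> dist x y"
  shows "\<exists>q\<in>{x, y}. \<exists>k::nat. ennreal (volume_const TYPE('a) / (16 * 2 ^ d * 2 powr ((real d + 4) * (p - 1))) *
      (l / enn2real (ball_dev \<Omega>)) powr p * r powr (b * p + d) * ((1/2) ^ k) powr (d - 1/2))
    \<le> gradient_integral \<Omega> f p q ((1/2) ^ k * (2 * r))"
proof -
  define v where "v = volume_const TYPE('a)"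
  define D where "D = enn2real (ball_dev \<Omega>)"
  define N where "N = l * v * r powr (b + d) / (8 * D)"
  have v: "0 < v" by (simp add: v_def volume_const_pos)
  have "d \<ge> 1" using DIM_positive[where 'a='a] by (simp add: d_def)
  have "x \<noteq> y" using xy \<open>0 < l\<close> by (auto simp: level_set_def diff_quot_def)
  then have r: "0 < r" by (simp add: r_def)
  have D: "0 < D" using large_gradient_integral(2)[OF \<Omega> dev f \<open>0 < l\<close> xy] by (simp add: D_def)
  obtain q t where q: "q \<in> {x, y}" and t: "0 < t" "t \<le> 1"
    and N: "ennreal (N * t powr (d - 1/2)) < gradient_integral \<Omega> f 1 q (t * (2 * r))"
    using large_gradient_integral(1)[OF \<Omega> dev f \<open>0 < l\<close> xy]
    unfolding N_def v_def d_def D_def r_def by blast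
  define L where "L = l / D"
  have L: "0 < L" using D \<open>0 < l\<close> by (simp add: L_def)
  txt \<open>The height \<open>\<kappa>\<close> is chosen so that the constant part carries exactly half of the lower bound.\<close>
  define \<kappa> where "\<kappa> = L * r powr b * t powr (-1/2) / 2 ^ (d + 4)"
  have \<kappa>: "0 < \<kappa>" using L r t by (simp add: \<kappa>_def)
  define A where "A = gradient_integral \<Omega> f p q (t * (2 * r))"
  have split: "t powr (d - 1/2) = t powr (-1/2) * t ^ d" "r powr (b + d) = r powr b * r ^ d"
    using powr_add[of t "real d" "-1/2"] powr_add[of r b "real d"] t r by (simp_all add: powr_realpow)
  \<comment> \<open>The \<open>2 ^ (d + 4)\<close> in \<open>\<kappa>\<close> collects the 8 of
    \<open>N\<close>, the \<open>2 ^ d\<close> from the radius \<open>2 * r\<close> and the factor 2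
    on the right.\<close>
  have N_eq: "N * t powr (d - 1/2) = 2 * (\<kappa> * (v * (t * (2 * r)) ^ d))"
  proof -
    have "N * t powr (d - 1/2) = N * (t powr (-1/2) * t ^ d)" by (simp only: split)
    also have "\<dots> = 2 * (\<kappa> * (v * (t * (2 * r)) ^ d))"
      by (simp add: N_def \<kappa>_def split(2) L_def power_mult_distrib power_add field_simps)
    finally show ?thesis .
  qed
  have "ennreal (N * t powr (d - 1/2)) < ennreal (N * t powr (d - 1/2) / 2) + ennreal (\<kappa> powr (1 - p)) * A"
  proof (rule less_le_trans[OF N])
    have "N * t powr (d - 1/2) / 2 = \<kappa> * (v * (t * (2 * r)) ^ d)" by (simp add: N_eq)
    then show "gradient_integral \<Omega> f 1 q (t * (2 * r)) \<le>
        ennreal (N * t powr (d - 1/2) / 2) + ennreal (\<kappa> powr (1 - p)) * A"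
      using gradient_integral_powr[OF \<Omega>(2) f \<kappa> \<open>1 \<le> p\<close>, of "t * (2 * r)" q] t r
      by (simp only: A_def v_def d_def) simp
  qed
  have A_ge: "ennreal (v / (16 * 2 ^ d * 2 powr ((real d + 4) * (p - 1))) * L powr p * r powr (b * p + d) *
      (t powr (d - 1/2) * 2 ^ d)) \<le> A"
  \<comment> \<open>Only a finite \<open>A\<close> needs work: then the half can be subtracted
    within the reals.\<close>
  proof (cases A)
    case (real a)
    have "N * t powr (d - 1/2) < N * t powr (d - 1/2) / 2 + \<kappa> powr (1 - p) * a"
    proof -
      have "0 \<le> N * t powr (d - 1/2)" using \<kappa> v t r by (simp add: N_eq)
      then show ?thesis
        using \<open>_ < _ + ennreal (\<kappa> powr (1 - p)) * A\<close> \<open>0 \<le> a\<close> real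
        by (simp add: ennreal_mult'[symmetric] ennreal_plus[symmetric] ennreal_less_iff del: ennreal_plus)
    qed
    then have "N * t powr (d - 1/2) / 2 \<le> \<kappa> powr (1 - p) * a" by linarith
    then have "\<kappa> powr (p - 1) * (N * t powr (d - 1/2) / 2) \<le> \<kappa> powr (p - 1) * (\<kappa> powr (1 - p) * a)"
      by (rule mult_left_mono) simp
    also have "\<dots> = a" using \<kappa> by (simp add: mult.assoc[symmetric] powr_add[symmetric])
    finally have a: "\<kappa> powr (p - 1) * (N * t powr (d - 1/2) / 2) \<le> a" .
    \<comment> \<open>As \<open>t \<le> 1\<close>, the factor \<open>t powr (-1/2)\<close> of
      \<open>\<kappa>\<close> is at least 1, and dropping it lowers the power because
      \<open>p - 1\<close> is nonnegative.\<close>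
    have "(L * r powr b / 2 ^ (d + 4)) powr (p - 1) \<le> \<kappa> powr (p - 1)"
    proof (rule powr_mono2)
      have "1 \<le> t powr (-1/2)" using t powr_mono2'[of "-1/2" t 1] by simp
      then have "L * r powr b / 2 ^ (d + 4) * 1 \<le> L * r powr b / 2 ^ (d + 4) * t powr (-1/2)"
        using L by (intro mult_left_mono) auto
      then show "L * r powr b / 2 ^ (d + 4) \<le> \<kappa>" by (simp add: \<kappa>_def)
    qed (use \<open>1 \<le> p\<close> L in auto)
    moreover have "(L * r powr b / 2 ^ (d + 4)) powr (p - 1) =
        L powr (p - 1) * r powr (b * (p - 1)) / 2 powr ((real d + 4) * (p - 1))"
    proof -
      have "(2::real) ^ (d + 4) = 2 powr (real d + 4)"
        using powr_realpow[of "2::real" "d + 4"] by simp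
      then show ?thesis using L r by (simp only: powr_divide powr_mult powr_powr)
    qed
    ultimately have "L powr (p - 1) * r powr (b * (p - 1)) / 2 powr ((real d + 4) * (p - 1)) * (N * t powr (d - 1/2) / 2) \<le> a"
    proof -
      assume *: "(L * r powr b / 2 ^ (d + 4)) powr (p - 1) \<le> \<kappa> powr (p - 1)"
        and eq: "(L * r powr b / 2 ^ (d + 4)) powr (p - 1) =
          L powr (p - 1) * r powr (b * (p - 1)) / 2 powr ((real d + 4) * (p - 1))"
      have "0 \<le> N * t powr (d - 1/2) / 2" using \<kappa> v t r by (simp add: N_eq)
      with * have "(L * r powr b / 2 ^ (d + 4)) powr (p - 1) * (N * t powr (d - 1/2) / 2)
          \<le> \<kappa> powr (p - 1) * (N * t powr (d - 1/2) / 2)" by (rule mult_right_mono)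
      then show ?thesis using a unfolding eq by linarith
    qed
    also have "L powr (p - 1) * r powr (b * (p - 1)) / 2 powr ((real d + 4) * (p - 1)) * (N * t powr (d - 1/2) / 2) =
       v / (16 * 2 powr ((real d + 4) * (p - 1))) * (L powr (p - 1) * L) * (r powr (b * (p - 1)) * r powr (b + d)) * t powr (d - 1/2)"
      by (simp add: N_def L_def field_simps)
    also have "L powr (p - 1) * L = L powr p" using L powr_add[of L "p - 1" 1] by simp
    \<comment> \<open>With \<open>b = \<gamma> / p\<close> this exponent becomes
      \<open>\<gamma> + d\<close>.\<close>
    also have "r powr (b * (p - 1)) * r powr (b + d) = r powr (b * p + d)"
      by (simp add: powr_add[symmetric] algebra_simps)
    finally show ?thesis
      using real \<open>0 \<le> a\<close> by (simp add: ennreal_leI field_simps)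
  qed simp
  \<comment> \<open>The bracket applied to \<open>2 * t\<close> rounds \<open>t\<close> up by a
    factor of at most 2. The larger radius only increases the integral, and the power with exponent
    \<open>d - 1/2\<close> grows by at most \<open>2 ^ d\<close>.\<close>
  obtain k where k: "t \<le> (1/2) ^ k" "(1/2) ^ k \<le> 2 * t"
    using dyadic_bracket_small[of "2 * t"] t by auto
  have "((1/2) ^ k) powr (d - 1/2) \<le> (2 * t) powr (d - 1/2)"
    using k \<open>d \<ge> 1\<close> by (intro powr_mono2) auto
  also have "\<dots> = t powr (d - 1/2) * 2 powr (d - 1/2)" using t by (simp add: powr_mult)
  also have "\<dots> \<le> t powr (d - 1/2) * 2 ^ d"
  proof (rule mult_left_mono)
    have "2 powr (d - 1/2) \<le> (2::real) powr d" by (rule powr_mono) auto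
    then show "2 powr (d - 1/2) \<le> (2::real) ^ d" by (simp add: powr_realpow)
  qed simp
  finally have tk: "((1/2) ^ k) powr (d - 1/2) \<le> t powr (d - 1/2) * 2 ^ d" .
  let ?c = "v / (16 * 2 ^ d * 2 powr ((real d + 4) * (p - 1))) * L powr p * r powr (b * p + d)"
  have "ennreal (?c * ((1/2) ^ k) powr (d - 1/2)) \<le> ennreal (?c * (t powr (d - 1/2) * 2 ^ d))"
    using v by (intro ennreal_leI mult_left_mono tk) auto
  also have "\<dots> \<le> A" by (rule A_ge)
  also have "A \<le> gradient_integral \<Omega> f p q ((1/2) ^ k * (2 * r))"
  proof -
    have "t * (2 * r) \<le> (1/2) ^ k * (2 * r)" using k r by (intro mult_right_mono) auto
    then have "ball q (t * (2 * r)) \<subseteq> ball q ((1/2) ^ k * (2 * r))" by (rule subset_ball)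
    then have "indicator (ball q (t * (2 * r)) \<inter> \<Omega>) z \<le> (indicator (ball q ((1/2) ^ k * (2 * r)) \<inter> \<Omega>) z :: ennreal)" for z
      by (intro indicator_leI) blast
    then show ?thesis
      unfolding A_def gradient_integral_def by (intro nn_integral_mono mult_left_mono) simp_all
  qed
  finally show ?thesis
    using q unfolding v_def L_def D_def by (intro bexI[of _ q] exI[of _ k]) auto
qed

section \<open>Summation over shells, selected balls and dyadic scales\<close>

lemma ennreal_mult_le_imp_le_divide:
  fixes X Y :: ennreal and q r :: real
  assumes "X * ennreal q \<le> ennreal r * Y" "0 < q" "0 \<le> r"
  shows "X \<le> ennreal (r / q) * Y"
proof -
  have inv: "ennreal q * ennreal (1 / q) = 1"
    using assms(2) by (subst ennreal_mult[symmetric]) auto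
  have "X = X * ennreal q * ennreal (1 / q)" by (simp only: mult.assoc inv mult_1_right)
  also have "\<dots> \<le> ennreal r * Y * ennreal (1 / q)" by (intro mult_right_mono assms) auto
  also have "\<dots> = ennreal r * ennreal (1 / q) * Y" by (simp only: ac_simps)
  also have "ennreal r * ennreal (1 / q) = ennreal (r * (1 / q))"
    using assms by (intro ennreal_mult[symmetric]) auto
  finally show ?thesis by simp
qed

definition shell_const :: "'a::euclidean_space itself \<Rightarrow> real \<Rightarrow> real" where
  "shell_const T \<gamma> = 2 powr \<bar>\<gamma> - DIM('a)\<bar> * (volume_const T)\<^sup>2 * (2 ^ DIM('a) + 4 ^ DIM('a))"

context weighted_domain
begin

lemma sets_mu_meas: "sets (mu_meas \<Omega> \<gamma> u) = sets (M \<Otimes>\<^sub>M M)"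
  by (simp add: mu_meas_def)

text \<open>Division of \<open>shell_estimate\<close> by the lower bound for the energy. Both radii
  of the shell are proportional to \<open>t\<close>, so \<open>t powr (\<gamma> + d)\<close> cancels
  and the constant is the same for selected balls of every size. The distance
  \<open>\<sigma> * t / (2 * \<tau>)\<close> belongs to a ball of radius
  \<open>\<sigma> * t\<close>, as a pair at distance \<open>r\<close> carries balls of radius
  \<open>2 * \<tau> * r\<close>.\<close>

lemma shell_le_weighted_energy:
  fixes \<gamma> :: real
  defines "d \<equiv> CARD('n)"
  assumes "0 < m" "0 < \<tau>" "0 < t" "0 < \<sigma>" "1 \<le> \<alpha>"
    and energy: "ennreal (m * t powr (\<gamma> + d)) \<le> energy c t"
  shows "emeasure (mu_meas \<Omega> \<gamma> u) (shell c (\<alpha> * t) (\<sigma> * t / (2 * \<tau>))) \<le>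
    ennreal (shell_const TYPE(real ^ 'n) \<gamma> * (2 * \<tau>) powr (- \<gamma>) / m) * ennreal (\<sigma> powr \<gamma> * \<alpha> ^ d) * weighted_energy c t"
proof -
  let ?\<rho> = "\<sigma> * t / (2 * \<tau>)"
  let ?X = "emeasure (mu_meas \<Omega> \<gamma> u) (shell c (\<alpha> * t) ?\<rho>)"
  have sc: "0 \<le> shell_const TYPE(real ^ 'n) \<gamma>" by (simp add: shell_const_def)
  have "?X * ennreal (m * t powr (\<gamma> + d)) \<le> ?X * energy c t"
    using energy by (rule mult_left_mono) simp
  also have "\<dots> \<le> ennreal (shell_const TYPE(real ^ 'n) \<gamma> * ?\<rho> powr \<gamma> * (\<alpha> * t) ^ d) * weighted_energy c t"
    using shell_estimate[of "\<alpha> * t" ?\<rho> t \<gamma> c] assms by (simp add: shell_const_def d_def)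
  finally have "?X \<le> ennreal (shell_const TYPE(real ^ 'n) \<gamma> * ?\<rho> powr \<gamma> * (\<alpha> * t) ^ d / (m * t powr (\<gamma> + d))) * weighted_energy c t"
    by (rule ennreal_mult_le_imp_le_divide) (use assms sc in auto)
  also have "shell_const TYPE(real ^ 'n) \<gamma> * ?\<rho> powr \<gamma> * (\<alpha> * t) ^ d / (m * t powr (\<gamma> + d)) =
      shell_const TYPE(real ^ 'n) \<gamma> * (2 * \<tau>) powr (- \<gamma>) / m * (\<sigma> powr \<gamma> * \<alpha> ^ d)"
  proof -
    have "?\<rho> powr \<gamma> = \<sigma> powr \<gamma> * t powr \<gamma> / (2 * \<tau>) powr \<gamma>"
      using assms by (simp only: powr_divide powr_mult)
    moreover have "t powr (\<gamma> + d) = t powr \<gamma> * t ^ d"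
      using assms by (simp add: powr_add powr_realpow)
    moreover have "(2 * \<tau>) powr (- \<gamma>) = 1 / (2 * \<tau>) powr \<gamma>" by (rule powr_minus_divide)
    ultimately show ?thesis using assms by (simp add: power_mult_distrib)
  qed
  also have "ennreal \<dots> = ennreal (shell_const TYPE(real ^ 'n) \<gamma> * (2 * \<tau>) powr (- \<gamma>) / m) * ennreal (\<sigma> powr \<gamma> * \<alpha> ^ d)"
    using assms sc by (intro ennreal_mult) auto
  finally show ?thesis .
qed

lemma sum_weighted_energy_le:
  assumes "disjoint_family (B :: nat \<Rightarrow> (real ^ 'n) set)" "\<And>n. open (B n)"
  shows "(\<Sum>n. \<integral>\<^sup>+x. h x * W x * indicator (B n) x \<partial>M) \<le> (\<integral>\<^sup>+x. h x * W x \<partial>M)"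
proof -
  have "(\<Sum>n. \<integral>\<^sup>+x. h x * W x * indicator (B n) x \<partial>M) = (\<integral>\<^sup>+x. (\<Sum>n. h x * W x * indicator (B n) x) \<partial>M)"
  proof (rule nn_integral_suminf[symmetric])
    show "(\<lambda>x. h x * W x * indicator (B n) x) \<in> borel_measurable M" for n
      using assms(2) borel_measurable_times_ennreal[OF measurable_h measurable_W]
      by (intro borel_measurable_times_ennreal[OF _ measurable_indicator_M]) auto
  qed
  also have "\<dots> = (\<integral>\<^sup>+x. h x * W x * indicator (\<Union>n. B n) x \<partial>M)"
    by (simp only: ennreal_suminf_cmult suminf_indicator[OF assms(1)])
  also have "\<dots> \<le> (\<integral>\<^sup>+x. h x * W x \<partial>M)"
    by (intro nn_integral_mono) (auto split: split_indicator)
  finally show ?thesis .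
qed

text \<open>At the scale \<open>\<tau>\<close> a pair is captured when \<open>K\<close> contains the
  ball of radius \<open>2 * \<tau> * dist x y\<close> around one of its points. Every such pair lies
  in a shell around a selected ball; the shells of one ball sum to the convergent series, and the
  disjoint balls to at most the total integral. A measurable superset \<open>T\<close> is provided
  so that the scales can be added by countable subadditivity.\<close>

lemma scale_estimate:
  fixes \<gamma> :: real and \<sigma> \<alpha> :: "nat \<Rightarrow> real"
  defines "d \<equiv> CARD('n)"
  assumes pos: "\<forall>j. 0 < \<sigma> j \<and> 1 \<le> \<alpha> j" and sum: "summable (\<lambda>j. \<sigma> j powr \<gamma> * \<alpha> j ^ d)"
    and select: "\<exists>C\<subseteq>K. disjoint_family_on (\<lambda>(c, t). ball c t) C \<and>
        (\<forall>(z, s)\<in>K. \<exists>(c, t)\<in>C. \<exists>j. \<sigma> j / 2 * t \<le> s \<and> s \<le> \<sigma> j * t \<and> dist z c < \<alpha> j * t)"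
    and K: "\<And>z s. (z, s) \<in> K \<Longrightarrow> 0 < s \<and> ennreal (m * s powr (\<gamma> + d)) \<le> energy z s"
    and "0 < m" "0 < \<tau>"
  shows "\<exists>T\<in>sets (mu_meas \<Omega> \<gamma> u).
    {(x, y). x \<in> \<Omega> \<and> y \<in> \<Omega> \<and> (\<exists>z\<in>{x, y}. (z, 2 * \<tau> * dist x y) \<in> K)} \<subseteq> T \<and>
    emeasure (mu_meas \<Omega> \<gamma> u) T \<le>
      ennreal (shell_const TYPE(real ^ 'n) \<gamma> * (2 * \<tau>) powr (- \<gamma>) / m * (\<Sum>j. \<sigma> j powr \<gamma> * \<alpha> j ^ d)) * (\<integral>\<^sup>+x. h x * W x \<partial>M)"
proof -
  obtain C where C: "C \<subseteq> K" "disjoint_family_on (\<lambda>(c, t). ball c t) C"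
    and cover_all: "\<forall>(z, s)\<in>K. \<exists>(c, t)\<in>C. \<exists>j. \<sigma> j / 2 * t \<le> s \<and> s \<le> \<sigma> j * t \<and> dist z c < \<alpha> j * t"
    using select by (elim exE conjE) (rule that)
  have cover: "\<exists>(c, t)\<in>C. \<exists>j. \<sigma> j / 2 * t \<le> s \<and> s \<le> \<sigma> j * t \<and> dist z c < \<alpha> j * t"
    if "(z, s) \<in> K" for z s
    using bspec[OF cover_all that] by simp
  define B where "B = (\<lambda>(c, t). ball c t :: (real ^ 'n) set)"
  have B_ne: "B i \<noteq> {}" if "i \<in> C" for i
    using K[of "fst i" "snd i"] that C(1) by (auto simp: B_def split_beta)
  have B_disj: "B i \<inter> B j = {}" if "i \<in> C" "j \<in> C" "i \<noteq> j" for i j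
    using C(2) that unfolding B_def disjoint_family_on_def by blast
  \<comment> \<open>Disjoint nonempty open sets are countable in number, so the shells can be
    enumerated.\<close>
  have "countable C"
  proof -
    have "inj_on B C" using B_ne B_disj by (metis Int_absorb inj_onI)
    moreover have "countable (B ` C)"
    proof (rule countable_disjoint_open_subsets)
      show "open S" if "S \<in> B ` C" for S using that by (auto simp: B_def)
      show "disjoint (B ` C)"
        unfolding pairwise_def disjnt_def using B_disj by (metis imageE)
    qed
    ultimately show ?thesis by (rule countable_image_inj_on[rotated])
  qed
  \<comment> \<open>The selected family is indexed by naturals, with empty sets outside
    \<open>I\<close>, so that finite and infinite families are treated alike.\<close>
  define I where "I = to_nat_on C ` C"
  define e where "e = from_nat_into C"
  have e: "e n \<in> C" "to_nat_on C (e n) = n" if "n \<in> I" for n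
    using that \<open>countable C\<close> by (auto simp: I_def e_def)
  have e_onto: "\<exists>n\<in>I. e n = i" if "i \<in> C" for i
    using that \<open>countable C\<close> by (auto simp: I_def e_def)
  define Sh where "Sh n j = (if n \<in> I then shell (fst (e n)) (\<alpha> j * snd (e n)) (\<sigma> j * snd (e n) / (2 * \<tau>)) else {})" for n j
  define Bn where "Bn n = (if n \<in> I then B (e n) else {})" for n
  let ?\<mu> = "emeasure (mu_meas \<Omega> \<gamma> u)" and ?k = "shell_const TYPE(real ^ 'n) \<gamma> * (2 * \<tau>) powr (- \<gamma>) / m"
  let ?s = "\<lambda>j. \<sigma> j powr \<gamma> * \<alpha> j ^ d"
  have k: "0 \<le> ?k" using assms by (simp add: shell_const_def)
  have s: "0 \<le> ?s j" for j using pos by (metis dual_order.trans mult_nonneg_nonneg powr_ge_zero zero_le_one zero_le_power)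
  have Sh_meas: "Sh n j \<in> sets (mu_meas \<Omega> \<gamma> u)" for n j
    by (simp add: Sh_def sets_mu_meas sets_shell)
  have Sh_le: "?\<mu> (Sh n j) \<le> ennreal ?k * ennreal (?s j) * (\<integral>\<^sup>+x. h x * W x * indicator (Bn n) x \<partial>M)" for n j
  proof (cases "n \<in> I")
    case True
    then have "(fst (e n), snd (e n)) \<in> K" using e C by auto
    from K[OF this] show ?thesis
      using shell_le_weighted_energy[OF \<open>0 < m\<close> \<open>0 < \<tau>\<close>, of "snd (e n)" "\<sigma> j" "\<alpha> j" \<gamma> "fst (e n)"] pos True
      by (simp add: Sh_def Bn_def B_def d_def weighted_energy_def split_beta)
  qed (simp add: Sh_def)
  have "?\<mu> (\<Union>n. \<Union>j. Sh n j) \<le> (\<Sum>n. ?\<mu> (\<Union>j. Sh n j))"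
    using Sh_meas by (intro emeasure_subadditive_countably) auto
  also have "\<dots> \<le> (\<Sum>n. \<Sum>j. ?\<mu> (Sh n j))"
    using Sh_meas by (intro suminf_le emeasure_subadditive_countably) auto
  also have "\<dots> \<le> (\<Sum>n. \<Sum>j. ennreal ?k * ennreal (?s j) * (\<integral>\<^sup>+x. h x * W x * indicator (Bn n) x \<partial>M))"
    by (intro suminf_le Sh_le) auto
  also have "\<dots> = ennreal ?k * ennreal (suminf ?s) * (\<Sum>n. \<integral>\<^sup>+x. h x * W x * indicator (Bn n) x \<partial>M)"
  proof -
    have "(\<Sum>j. ennreal (?s j)) = ennreal (suminf ?s)"
      using s sum by (rule suminf_ennreal2)
    then show ?thesis by (simp add: ennreal_suminf_multc ennreal_suminf_cmult)
  qed
  also have "\<dots> \<le> ennreal ?k * ennreal (suminf ?s) * (\<integral>\<^sup>+x. h x * W x \<partial>M)"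
  proof (rule mult_left_mono[OF sum_weighted_energy_le])
    show "disjoint_family Bn"
      unfolding disjoint_family_on_def
    proof (intro ballI impI)
      fix i j :: nat assume "i \<noteq> j"
      then have "e i \<noteq> e j" if "i \<in> I" "j \<in> I" using that e(2) by metis
      then have "B (e i) \<inter> B (e j) = {}" if "i \<in> I" "j \<in> I"
        using that by (intro B_disj e(1)) blast+
      then show "Bn i \<inter> Bn j = {}" by (simp add: Bn_def)
    qed
    show "open (Bn n)" for n by (auto simp: Bn_def B_def split_beta)
  qed simp
  also have "ennreal ?k * ennreal (suminf ?s) = ennreal (?k * suminf ?s)"
    using k s sum by (intro ennreal_mult[symmetric] suminf_nonneg) auto
  finally have le: "?\<mu> (\<Union>n. \<Union>j. Sh n j) \<le> ennreal (?k * suminf ?s) * (\<integral>\<^sup>+x. h x * W x \<partial>M)" .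
  have "(x, y) \<in> (\<Union>n. \<Union>j. Sh n j)"
    if xy: "x \<in> \<Omega>" "y \<in> \<Omega>" "z \<in> {x, y}" "(z, 2 * \<tau> * dist x y) \<in> K" for x y z
  proof -
    obtain c t j where ct: "(c, t) \<in> C" and j: "\<sigma> j / 2 * t \<le> 2 * \<tau> * dist x y"
      "2 * \<tau> * dist x y \<le> \<sigma> j * t" "dist z c < \<alpha> j * t"
      using cover[OF xy(4)] by auto
    obtain n where n: "n \<in> I" "e n = (c, t)" using e_onto[OF ct] by blast
    have "(x, y) \<in> Sh n j"
      using n j xy \<open>0 < \<tau>\<close>
      by (auto simp: Sh_def shell_def dist_norm norm_minus_commute field_simps)
    then show ?thesis by blast
  qed
  then have "{(x, y). x \<in> \<Omega> \<and> y \<in> \<Omega> \<and> (\<exists>z\<in>{x, y}. (z, 2 * \<tau> * dist x y) \<in> K)} \<subseteq> (\<Union>n. \<Union>j. Sh n j)"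
    by (intro subsetI, elim CollectE case_prodE conjE bexE) simp
  moreover have "(\<Union>n. \<Union>j. Sh n j) \<in> sets (mu_meas \<Omega> \<gamma> u)"
    using Sh_meas by auto
  ultimately show ?thesis using le by (intro bexI conjI)
qed

end

lemma gradient_integral_eq_lebesgue_on:
  assumes "open \<Omega>"
  shows "gradient_integral \<Omega> f p q s =
    (\<integral>\<^sup>+z. ennreal (norm (gradient f z) powr p) * indicator (ball q s) z \<partial>lebesgue_on \<Omega>)"
proof -
  have "(\<integral>\<^sup>+z. ennreal (norm (gradient f z) powr p) * indicator (ball q s) z \<partial>lebesgue_on \<Omega>) =
      (\<integral>\<^sup>+z. ennreal (norm (gradient f z) powr p) * indicator (ball q s) z * indicator \<Omega> z \<partial>lebesgue)"
    using assms by (intro nn_integral_restrict_space) auto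
  also have "\<dots> = (\<integral>\<^sup>+z. ennreal (norm (gradient f z) powr p) * indicator (ball q s \<inter> \<Omega>) z \<partial>lebesgue)"
    by (simp only: indicator_inter_arith mult.assoc)
  finally show ?thesis by (simp add: gradient_integral_def nn_integral_completion)
qed

lemma measurable_gradient_lebesgue_on:
  assumes "open \<Omega>" "C1_on \<Omega> f"
  shows "(\<lambda>z. ennreal (norm (gradient f z) powr p)) \<in> borel_measurable (lebesgue_on \<Omega>)"
proof -
  have "(\<lambda>z. ennreal (norm (gradient f z) powr p) * indicator \<Omega> z) \<in> borel_measurable lebesgue"
    using measurable_gradient_on[OF assms] by (intro measurable_completion) simp
  then have "(\<lambda>z. ennreal (norm (gradient f z) powr p) * indicator \<Omega> z) \<in> borel_measurable (lebesgue_on \<Omega>)"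
    by (rule measurable_restrict_space1)
  then show ?thesis
    by (rule measurable_cong[THEN iffD1, rotated]) (simp add: space_restrict_space)
qed

text \<open>The scales \<open>(1/2) ^ k\<close> contribute a geometric series of ratio \<open>(1/2) powr (1/2)\<close>, uniformly
  in the cutoff \<open>n\<close>.\<close>

lemma truncated_level_set_le:
  fixes f :: "real ^ 'n::finite \<Rightarrow> real" and p \<gamma> :: real and \<sigma> \<alpha> :: "nat \<Rightarrow> real"
  defines "d \<equiv> CARD('n)"
  assumes pos: "\<forall>j. 0 < \<sigma> j \<and> 1 \<le> \<alpha> j" and sum: "summable (\<lambda>j. \<sigma> j powr \<gamma> * \<alpha> j ^ d)"
    and select: "\<forall>(K :: ((real ^ 'n) \<times> real) set) \<delta> M. 0 < \<delta> \<and> (\<forall>(z, s)\<in>K. \<delta> \<le> s \<and> s \<le> M) \<longrightarrow>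
      (\<exists>C\<subseteq>K. disjoint_family_on (\<lambda>(c, t). ball c t) C \<and>
        (\<forall>(z, s)\<in>K. \<exists>(c, t)\<in>C. \<exists>j. \<sigma> j / 2 * t \<le> s \<and> s \<le> \<sigma> j * t \<and> dist z c < \<alpha> j * t))"
    and wd: "weighted_domain \<Omega> u (\<lambda>z. ennreal (norm (gradient f z) powr p)) W"
    and \<Omega>: "convex \<Omega>" "open \<Omega>" and dev: "ball_dev \<Omega> < top" and f: "C1_on \<Omega> f" and "0 < l" and p: "1 \<le> p"
    and "0 < \<delta>"
    and E: "E \<subseteq> level_set \<Omega> l (\<gamma> / p) f" "\<And>x y. (x, y) \<in> E \<Longrightarrow> \<delta> \<le> dist x y \<and> dist x y \<le> R"
  shows "emeasure (mu_meas \<Omega> \<gamma> u) E \<le>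
    ennreal (shell_const TYPE(real ^ 'n) \<gamma> * (\<Sum>j. \<sigma> j powr \<gamma> * \<alpha> j ^ d) * 2 ^ d *
      (16 * 2 ^ d * 2 powr ((real d + 4) * (p - 1))) / volume_const TYPE(real ^ 'n) / (1 - (1/2) powr (1/2)) *
      (enn2real (ball_dev \<Omega>) / l) powr p) *
    (\<integral>\<^sup>+x. ennreal (norm (gradient f x) powr p) * W x \<partial>lebesgue_on \<Omega>)"
proof -
  interpret weighted_domain \<Omega> u "\<lambda>z. ennreal (norm (gradient f z) powr p)" W by (rule wd)
  let ?\<mu> = "emeasure (mu_meas \<Omega> \<gamma> u)"
  define I where "I = (\<integral>\<^sup>+x. ennreal (norm (gradient f x) powr p) * W x \<partial>lebesgue_on \<Omega>)"
  define D where "D = enn2real (ball_dev \<Omega>)"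
  define c where "c = volume_const TYPE(real ^ 'n) / (16 * 2 ^ d * 2 powr ((real d + 4) * (p - 1)))"
  define S where "S = (\<Sum>j. \<sigma> j powr \<gamma> * \<alpha> j ^ d)"
  show ?thesis
  proof (cases "E = {}")
    case True
    then show ?thesis by simp
  next
    case False
    \<comment> \<open>Positivity of the deviation is drawn from a pair in the level set, whence the
      separate case of empty \<open>E\<close>.\<close>
    then obtain x0 y0 where "(x0, y0) \<in> level_set \<Omega> l (\<gamma> / p) f" using E(1) by fast
    then have D: "0 < D"
      using large_gradient_integral(2)[OF \<Omega> dev f \<open>0 < l\<close>] by (simp add: D_def)
    have c: "0 < c" by (simp add: c_def volume_const_pos)
    have S: "0 \<le> S" unfolding S_def using pos sum
      by (intro suminf_nonneg) (auto intro!: mult_nonneg_nonneg zero_le_power intro: order_trans[of 0 1])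
    have sc: "0 \<le> shell_const TYPE(real ^ 'n) \<gamma>" by (simp add: shell_const_def)
    \<comment> \<open>Chosen so that for \<open>s = 2 * (1/2) ^ k * r\<close> the product
      \<open>m k * s powr (\<gamma> + d)\<close> is the lower bound of
      \<open>large_powr_gradient_integral\<close> for a pair at distance \<open>r\<close>.\<close>
    define m where "m k = c * (l / D) powr p * (2 * (1/2) ^ k) powr (- (\<gamma> + d)) * ((1/2) ^ k) powr (d - 1/2)" for k :: nat
    \<comment> \<open>The truncation of the distances by \<open>\<delta>\<close> and
      \<open>R\<close> confines the radii of each scale between positive and finite bounds, as the
      selection requires.\<close>
    define K where "K k = {(z, s). 2 * (1/2) ^ k * \<delta> \<le> s \<and> s \<le> 2 * (1/2) ^ k * R \<and>
      ennreal (m k * s powr (\<gamma> + d)) \<le> energy z s}" for k :: nat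
    define P where "P k = {(x, y). x \<in> \<Omega> \<and> y \<in> \<Omega> \<and> (\<exists>z\<in>{x, y}. (z, 2 * (1/2) ^ k * dist x y) \<in> K k)}" for k
    have m: "0 < m k" for k using c \<open>0 < l\<close> D by (simp add: m_def)
    have "\<exists>T\<in>sets (mu_meas \<Omega> \<gamma> u). P k \<subseteq> T \<and>
        ?\<mu> T \<le> ennreal (shell_const TYPE(real ^ 'n) \<gamma> * (2 * (1/2) ^ k) powr (- \<gamma>) / m k * S) * I" for k
      unfolding P_def S_def I_def d_def
    proof (rule scale_estimate)
      show "\<exists>C\<subseteq>K k. disjoint_family_on (\<lambda>(c, t). ball c t) C \<and>
        (\<forall>(z, s)\<in>K k. \<exists>(c, t)\<in>C. \<exists>j. \<sigma> j / 2 * t \<le> s \<and> s \<le> \<sigma> j * t \<and> dist z c < \<alpha> j * t)"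
      proof (rule select[rule_format])
        show "0 < 2 * (1/2) ^ k * \<delta> \<and> (\<forall>(z, s)\<in>K k. 2 * (1/2) ^ k * \<delta> \<le> s \<and> s \<le> 2 * (1/2) ^ k * R)"
          using \<open>0 < \<delta>\<close> by (auto simp: K_def)
      qed
      show "0 < s \<and> ennreal (m k * s powr (\<gamma> + CARD('n))) \<le> energy z s" if "(z, s) \<in> K k" for z s
      proof -
        have "0 < 2 * (1/2) ^ k * \<delta>" using \<open>0 < \<delta>\<close> by simp
        moreover have "2 * (1/2) ^ k * \<delta> \<le> s" using that by (simp add: K_def)
        ultimately have "0 < s" by linarith
        then show ?thesis using that by (simp add: K_def d_def)
      qed
    qed (use pos sum m in \<open>auto simp: d_def\<close>)
    then obtain T where T: "\<And>k. T k \<in> sets (mu_meas \<Omega> \<gamma> u)" "\<And>k. P k \<subseteq> T k"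
      "\<And>k. ?\<mu> (T k) \<le> ennreal (shell_const TYPE(real ^ 'n) \<gamma> * (2 * (1/2) ^ k) powr (- \<gamma>) / m k * S) * I"
      by metis
    define a where "a = shell_const TYPE(real ^ 'n) \<gamma> * S * 2 ^ d / c * (D / l) powr p"
    have a: "0 \<le> a" using sc S c by (simp add: a_def)
    \<comment> \<open>The factors \<open>(2 * \<tau>) powr (- \<gamma>)\<close> and
      \<open>\<tau> ^ d\<close> cancel, where \<open>\<tau> = (1/2) ^ k\<close>. There remain
      \<open>2 ^ d\<close> and the gain \<open>\<tau> powr (1/2)\<close>, which stems from the
      exponent \<open>d - 1/2\<close>.\<close>
    have coeff: "shell_const TYPE(real ^ 'n) \<gamma> * (2 * (1/2) ^ k) powr (- \<gamma>) / m k * S = a * ((1/2) powr (1/2)) ^ k" for k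
    proof -
      define \<tau> where "\<tau> = (1/2::real) ^ k"
      have \<tau>: "0 < \<tau>" by (simp add: \<tau>_def)
      have 1: "(2 * \<tau>) powr (- (\<gamma> + d)) = (2 * \<tau>) powr (- \<gamma>) / (2 ^ d * \<tau> ^ d)"
        using \<tau> powr_add[of "2 * \<tau>" "- \<gamma>" "- real d"]
        by (simp add: powr_minus_divide powr_realpow power_mult_distrib)
      have 2: "\<tau> powr (d - 1/2) = \<tau> ^ d / \<tau> powr (1/2)"
        using \<tau> by (simp only: powr_diff powr_realpow)
      have 3: "(l / D) powr p = 1 / (D / l) powr p"
        using D \<open>0 < l\<close> by (simp add: powr_divide)
      have "((1/2) powr (1/2)) ^ k = \<tau> powr (1/2)"
        unfolding \<tau>_def by (rule power_powr_commute[symmetric]) simp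
      then show ?thesis
        unfolding m_def \<tau>_def[symmetric] 1 2 3 a_def using \<tau> D \<open>0 < l\<close> c by simp
    qed
    have "E \<subseteq> (\<Union>k. T k)"
    proof (rule subrelI)
      fix x y assume xy: "(x, y) \<in> E"
      then have ls: "(x, y) \<in> level_set \<Omega> l (\<gamma> / p) f" using E(1) by blast
      define r where "r = dist x y"
      have r: "\<delta> \<le> r" "r \<le> R" using E(2)[OF xy] by (auto simp: r_def)
      have "\<exists>q\<in>{x, y}. \<exists>k::nat. ennreal (c * (l / D) powr p * r powr (\<gamma> / p * p + d) * ((1/2) ^ k) powr (d - 1/2))
          \<le> gradient_integral \<Omega> f p q ((1/2) ^ k * (2 * r))"
        using large_powr_gradient_integral[OF \<Omega> dev f \<open>0 < l\<close> ls p]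
        by (simp only: c_def D_def r_def d_def DIM_cart DIM_real mult_1_right)
      then obtain q and k :: nat where q: "q \<in> {x, y}"
        and big: "ennreal (c * (l / D) powr p * r powr (\<gamma> / p * p + d) * ((1/2) ^ k) powr (d - 1/2))
          \<le> gradient_integral \<Omega> f p q ((1/2) ^ k * (2 * r))"
        by (elim bexE exE) (rule that)
      have r_eq: "(2 * (1/2) ^ k) powr (- (\<gamma> + d)) * (2 * (1/2) ^ k * r) powr (\<gamma> + d) = r powr (\<gamma> + d)"
      proof -
        have "(2 * (1/2) ^ k * r) powr (\<gamma> + d) = (2 * (1/2) ^ k) powr (\<gamma> + d) * r powr (\<gamma> + d)"
          by (rule powr_mult)
        then show ?thesis by (simp add: powr_minus_divide del: minus_add_distrib)
      qed
      have "m k * (2 * (1/2) ^ k * r) powr (\<gamma> + d) =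
          c * (l / D) powr p * ((2 * (1/2) ^ k) powr (- (\<gamma> + d)) * (2 * (1/2) ^ k * r) powr (\<gamma> + d)) *
          ((1/2) ^ k) powr (d - 1/2)"
        by (simp only: m_def mult_ac)
      also have "\<dots> = c * (l / D) powr p * r powr (\<gamma> / p * p + d) * ((1/2) ^ k) powr (d - 1/2)"
        using p by (simp only: r_eq) simp
      finally have "ennreal (m k * (2 * (1/2) ^ k * r) powr (\<gamma> + d)) \<le> energy q (2 * (1/2) ^ k * r)"
        using big gradient_integral_eq_lebesgue_on[OF \<Omega>(2), of f p q "(1/2) ^ k * (2 * r)"]
        by (simp only: energy_def mult_ac)
      then have "(q, 2 * (1/2) ^ k * r) \<in> K k"
        using r by (simp add: K_def mult_left_mono)
      then have "(x, y) \<in> P k"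
        using q ls unfolding P_def r_def level_set_def by blast
      then show "(x, y) \<in> (\<Union>k. T k)" using T(2) by blast
    qed
    then have "?\<mu> E \<le> ?\<mu> (\<Union>k. T k)"
      using T(1) by (intro emeasure_mono) auto
    also have "\<dots> \<le> (\<Sum>k. ?\<mu> (T k))"
      using T(1) by (intro emeasure_subadditive_countably) auto
    also have "\<dots> \<le> (\<Sum>k. ennreal (a * ((1/2) powr (1/2)) ^ k) * I)"
      using T(3) unfolding coeff by (intro suminf_le) auto
    also have "\<dots> = (\<Sum>k. ennreal (a * ((1/2) powr (1/2)) ^ k)) * I"
      by (rule ennreal_suminf_multc)
    also have "(\<Sum>k. ennreal (a * ((1/2) powr (1/2)) ^ k)) = ennreal (a * (1 / (1 - (1/2) powr (1/2))))"
    proof (rule suminf_ennreal_eq)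
      have "(1/2) powr (1/2) < (1::real)" using powr_less_mono2[of "1/2" "1/2" "1::real"] by simp
      then show "(\<lambda>k. a * ((1/2) powr (1/2)) ^ k) sums (a * (1 / (1 - (1/2) powr (1/2))))"
        by (intro sums_mult geometric_sums) simp
    qed (use a in simp)
    also have "a * (1 / (1 - (1/2) powr (1/2))) =
      shell_const TYPE(real ^ 'n) \<gamma> * S * 2 ^ d * (16 * 2 ^ d * 2 powr ((real d + 4) * (p - 1))) / volume_const TYPE(real ^ 'n) /
        (1 - (1/2) powr (1/2)) * (D / l) powr p"
      by (simp add: a_def c_def)
    finally show ?thesis unfolding S_def I_def D_def .
  qed
qed

text \<open>Monotone exhaustion, since the bound for truncated level sets does not depend on the
  truncation. The sequences \<open>\<sigma>\<close> and \<open>\<alpha>\<close> are fixed before the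
  domain, the function and the weights, so the constant depends only on the dimension,
  \<open>p\<close> and \<open>\<gamma>\<close>.\<close>

lemma level_set_le:
  fixes p \<gamma> :: real
  assumes p: "1 \<le> p" and \<gamma>: "\<gamma> \<notin> {- real CARD('n::finite)..0}"
  shows "\<exists>C::real. 0 < C \<and>
    (\<forall>(\<Omega> :: (real ^ 'n) set) f l u W.
       convex \<Omega> \<and> ball_dev \<Omega> < top \<and> C1_on \<Omega> f \<and> 0 < l \<and>
       weighted_domain \<Omega> u (\<lambda>z. ennreal (norm (gradient f z) powr p)) W \<longrightarrow>
       emeasure (mu_meas \<Omega> \<gamma> u) (level_set \<Omega> l (\<gamma> / p) f) \<le>
         ennreal C * ennreal ((enn2real (ball_dev \<Omega>) / l) powr p) *
           (\<integral>\<^sup>+x\<in>\<Omega>. ennreal (norm (gradient f x) powr p) * W x \<partial>lebesgue))"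
proof -
  obtain \<sigma> \<alpha> :: "nat \<Rightarrow> real" where pos: "\<forall>j. 0 < \<sigma> j \<and> 1 \<le> \<alpha> j"
    and sum: "summable (\<lambda>j. \<sigma> j powr \<gamma> * \<alpha> j ^ CARD('n))"
    and select: "\<forall>(K :: ((real ^ 'n) \<times> real) set) \<delta> M. 0 < \<delta> \<and> (\<forall>(z, s)\<in>K. \<delta> \<le> s \<and> s \<le> M) \<longrightarrow>
      (\<exists>C\<subseteq>K. disjoint_family_on (\<lambda>(c, t). ball c t) C \<and>
        (\<forall>(z, s)\<in>K. \<exists>(c, t)\<in>C. \<exists>j. \<sigma> j / 2 * t \<le> s \<and> s \<le> \<sigma> j * t \<and> dist z c < \<alpha> j * t))"
    using ball_selection[OF \<gamma>, where 'a = "real ^ 'n"] by (elim exE conjE) (rule that)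
  define C where "C = shell_const TYPE(real ^ 'n) \<gamma> * (\<Sum>j. \<sigma> j powr \<gamma> * \<alpha> j ^ CARD('n)) * 2 ^ CARD('n) *
      (16 * 2 ^ CARD('n) * 2 powr ((real CARD('n) + 4) * (p - 1))) / volume_const TYPE(real ^ 'n) / (1 - (1/2) powr (1/2))"
  have "0 < \<sigma> j powr \<gamma> * \<alpha> j ^ CARD('n)" for j
    using pos[rule_format, of j] by (intro mult_pos_pos zero_less_power) auto
  then have "0 < (\<Sum>j. \<sigma> j powr \<gamma> * \<alpha> j ^ CARD('n))"
    by (rule suminf_pos[OF sum])
  moreover have "(1/2) powr (1/2) < (1::real)" using powr_less_mono2[of "1/2" "1/2" "1::real"] by simp
  moreover have "0 < shell_const TYPE(real ^ 'n) \<gamma>"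
    using volume_const_pos[where 'a = "real ^ 'n"] by (auto simp: shell_const_def intro!: mult_pos_pos add_pos_pos)
  ultimately have "0 < C"
    using volume_const_pos[where 'a = "real ^ 'n"] unfolding C_def
    by (intro divide_pos_pos mult_pos_pos) auto
  moreover have "emeasure (mu_meas \<Omega> \<gamma> u) (level_set \<Omega> l (\<gamma> / p) f) \<le>
         ennreal C * ennreal ((enn2real (ball_dev \<Omega>) / l) powr p) *
           (\<integral>\<^sup>+x\<in>\<Omega>. ennreal (norm (gradient f x) powr p) * W x \<partial>lebesgue)"
    if asm: "convex \<Omega>" "ball_dev \<Omega> < top" "C1_on \<Omega> f" "0 < l"
      and wd: "weighted_domain \<Omega> u (\<lambda>z. ennreal (norm (gradient f z) powr p)) W"
    for \<Omega> :: "(real ^ 'n) set" and f l u W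
  proof -
    interpret weighted_domain \<Omega> u "\<lambda>z. ennreal (norm (gradient f z) powr p)" W by (rule wd)
    let ?\<mu> = "mu_meas \<Omega> \<gamma> u" and ?E = "level_set \<Omega> l (\<gamma> / p) f"
    let ?D = "(enn2real (ball_dev \<Omega>) / l) powr p"
    define I where "I = (\<integral>\<^sup>+x. ennreal (norm (gradient f x) powr p) * W x \<partial>lebesgue_on \<Omega>)"
    have I: "(\<integral>\<^sup>+x\<in>\<Omega>. ennreal (norm (gradient f x) powr p) * W x \<partial>lebesgue) = I"
      unfolding I_def using open_domain by (intro nn_integral_restrict_space[symmetric]) auto
    txt \<open>Non-measurable sets have \<^const>\<open>emeasure\<close> 0, so measurability of the level set is not an issue.\<close>
    have "emeasure ?\<mu> ?E \<le> ennreal (C * ?D) * I"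
    proof (cases "?E \<in> sets ?\<mu>")
      case False
      then show ?thesis by (simp add: emeasure_notin_sets)
    next
      case True
      define A where "A n = {z \<in> ?E. 1 / real (Suc n) \<le> dist (fst z) (snd z) \<and> dist (fst z) (snd z) \<le> real (Suc n)}" for n
      have "A n \<in> sets ?\<mu>" for n
      proof -
        have "(\<lambda>z. dist (fst z) (snd z)) \<in> borel_measurable (M \<Otimes>\<^sub>M M)"
          using measurable_dist_M by (simp add: split_beta' dist_norm norm_minus_commute)
        then have "{z \<in> space (M \<Otimes>\<^sub>M M). 1 / real (Suc n) \<le> dist (fst z) (snd z) \<and> dist (fst z) (snd z) \<le> real (Suc n)}
            \<in> sets (M \<Otimes>\<^sub>M M)"
          by measurable
        then have "?E \<inter> {z \<in> space (M \<Otimes>\<^sub>M M). 1 / real (Suc n) \<le> dist (fst z) (snd z) \<and> dist (fst z) (snd z) \<le> real (Suc n)}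
            \<in> sets ?\<mu>"
          using True by (simp add: sets_mu_meas)
        also have "?E \<inter> {z \<in> space (M \<Otimes>\<^sub>M M). 1 / real (Suc n) \<le> dist (fst z) (snd z) \<and> dist (fst z) (snd z) \<le> real (Suc n)} = A n"
          by (auto simp: A_def level_set_def space_pair_measure)
        finally show ?thesis .
      qed
      moreover have "incseq A"
      proof (rule incseq_SucI)
        fix n
        have "1 / real (Suc (Suc n)) \<le> 1 / real (Suc n)" by (intro divide_left_mono) auto
        then show "A n \<subseteq> A (Suc n)" by (auto simp: A_def)
      qed
      ultimately have "(SUP n. emeasure ?\<mu> (A n)) = emeasure ?\<mu> (\<Union>n. A n)"
        by (intro SUP_emeasure_incseq) auto
      also have "(\<Union>n. A n) = ?E"
      proof
        show "?E \<subseteq> (\<Union>n. A n)"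
        proof
          fix z assume z: "z \<in> ?E"
          let ?r = "dist (fst z) (snd z)"
          \<comment> \<open>The difference quotient is 0 on the diagonal and \<open>l\<close> is
            positive, so the lower cutoffs of the distance lose no pair in the limit.\<close>
          have "0 < ?r" using z \<open>0 < l\<close> by (auto simp: level_set_def diff_quot_def)
          obtain n where n: "max ?r (1 / ?r) \<le> real n" using real_arch_simple by blast
          then have "1 / ?r \<le> real (Suc n)" "?r \<le> real (Suc n)" by auto
          then have "1 / real (Suc n) \<le> ?r" using \<open>0 < ?r\<close> by (simp add: field_simps)
          then have "z \<in> A n" using z \<open>?r \<le> real (Suc n)\<close> by (simp add: A_def)
          then show "z \<in> (\<Union>n. A n)" by blast
        qed
      qed (auto simp: A_def)
      finally have E: "(SUP n. emeasure ?\<mu> (A n)) = emeasure ?\<mu> ?E" .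
      have "emeasure ?\<mu> (A n) \<le> ennreal (C * ?D) * I" for n
        unfolding C_def I_def
      proof (rule truncated_level_set_le[OF pos sum select wd asm(1) open_domain asm(2-4) p])
        show "0 < 1 / real (Suc n)" by simp
        show "A n \<subseteq> ?E" by (auto simp: A_def)
        show "1 / real (Suc n) \<le> dist x y \<and> dist x y \<le> real (Suc n)" if "(x, y) \<in> A n" for x y
          using that by (simp add: A_def)
      qed
      then have "(SUP n. emeasure ?\<mu> (A n)) \<le> ennreal (C * ?D) * I" by (rule SUP_least)
      then show ?thesis by (simp only: E)
    qed
    also have "ennreal (C * ?D) = ennreal C * ennreal ?D"
      using \<open>0 < C\<close> by (intro ennreal_mult) auto
    finally show ?thesis by (simp only: I)
  qed
  ultimately show ?thesis by (intro exI[of _ C]) simp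
qed

section \<open>Majorants from the A_1 condition and from the maximal function\<close>

lemma nn_integral_lebesgue_on_ball:
  assumes "open \<Omega>"
  shows "(\<integral>\<^sup>+y. ennreal (u y) * indicator (ball c r) y \<partial>lebesgue_on \<Omega>) =
    (\<integral>\<^sup>+y\<in>ball c r \<inter> \<Omega>. ennreal (u y) \<partial>lebesgue)"
proof -
  have "(\<integral>\<^sup>+y. ennreal (u y) * indicator (ball c r) y \<partial>lebesgue_on \<Omega>) =
    (\<integral>\<^sup>+y. ennreal (u y) * indicator (ball c r) y * indicator \<Omega> y \<partial>lebesgue)"
    using assms by (intro nn_integral_restrict_space) auto
  then show ?thesis by (simp only: indicator_inter_arith mult.assoc)
qed

lemma emeasure_lebesgue_ball_bounds:
  fixes c :: "'a::euclidean_space"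
  assumes "0 < r"
  shows "emeasure lebesgue (ball c r) \<noteq> 0" "emeasure lebesgue (ball c r) \<noteq> top"
  using assms volume_const_pos[where 'a = 'a]
  by (simp_all add: emeasure_lebesgue_ball del: emeasure_completion)

text \<open>The supremum over admissible constants is already the supremum of a sequence of them, so
  only countably many null sets are united.\<close>

lemma AE_essinf_le: "AE x in M. essinf M g \<le> g x"
proof -
  have "{c. AE x in M. c \<le> g x} \<noteq> {}" by (auto intro!: exI[of _ 0])
  then obtain f :: "nat \<Rightarrow> ennreal" where f: "range f \<subseteq> {c. AE x in M. c \<le> g x}" "essinf M g = (SUP i. f i)"
    using ennreal_Sup_countable_SUP unfolding essinf_def by metis
  then have "AE x in M. \<forall>i. f i \<le> g x" by (simp add: AE_all_countable image_subset_iff)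
  then show ?thesis unfolding f(2) by eventually_elim (rule SUP_least, blast)
qed

lemma A1_bound_majorant:
  assumes "open \<Omega>" "A1_bound \<Omega> u w K" "0 < r"
  shows "AE x in lebesgue_on \<Omega>. x \<in> ball c r \<longrightarrow>
    (\<integral>\<^sup>+y. ennreal (u y) * indicator (ball c r) y \<partial>lebesgue_on \<Omega>)
      \<le> emeasure lebesgue (ball c r) * (K * ennreal (w x))"
proof -
  let ?B = "ball c r" and ?I = "\<integral>\<^sup>+y. ennreal (u y) * indicator (ball c r) y \<partial>lebesgue_on \<Omega>"
  have le: "?I / emeasure lebesgue ?B \<le> K * essinf (lebesgue_on (?B \<inter> \<Omega>)) (\<lambda>y. ennreal (w y))"
    using assms(2,3) unfolding A1_bound_def nn_integral_lebesgue_on_ball[OF assms(1)] by blast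
  have "AE x in lebesgue. x \<in> ?B \<inter> \<Omega> \<longrightarrow> essinf (lebesgue_on (?B \<inter> \<Omega>)) (\<lambda>y. ennreal (w y)) \<le> ennreal (w x)"
    using AE_essinf_le[of "lebesgue_on (?B \<inter> \<Omega>)" "\<lambda>y. ennreal (w y)"] assms(1)
    by (subst (asm) AE_restrict_space_iff) auto
  then have "AE x in lebesgue. x \<in> \<Omega> \<longrightarrow> x \<in> ?B \<longrightarrow> ?I \<le> emeasure lebesgue ?B * (K * ennreal (w x))"
  proof eventually_elim
    case (elim x)
    show ?case
    proof (intro impI)
      assume "x \<in> \<Omega>" "x \<in> ?B"
      then have "K * essinf (lebesgue_on (?B \<inter> \<Omega>)) (\<lambda>y. ennreal (w y)) \<le> K * ennreal (w x)"
        using elim by (intro mult_left_mono) auto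
      with le have "?I / emeasure lebesgue ?B \<le> K * ennreal (w x)" by (rule order_trans)
      then show "?I \<le> emeasure lebesgue ?B * (K * ennreal (w x))"
        using emeasure_lebesgue_ball_bounds[OF assms(3)] by (rule ennreal_divide_le_imp_le_mult)
    qed
  qed
  then show ?thesis using assms(1) by (subst AE_restrict_space_iff) auto
qed

text \<open>The infimum is approached by a decreasing sequence of admissible constants. Off one
  common null set the bound holds for each of them, and it passes to the limit pointwise.\<close>

lemma A1_const_majorant:
  assumes "open \<Omega>" "A1_pair \<Omega> u w" "0 < r"
  shows "AE x in lebesgue_on \<Omega>. x \<in> ball c r \<longrightarrow>
    (\<integral>\<^sup>+y. ennreal (u y) * indicator (ball c r) y \<partial>lebesgue_on \<Omega>)
      \<le> emeasure lebesgue (ball c r) * (A1_const \<Omega> u w * ennreal (w x))"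
proof -
  have "{K. A1_bound \<Omega> u w K} \<noteq> {}" using assms(2) by (auto simp: A1_pair_def)
  then obtain K :: "nat \<Rightarrow> ennreal" where K: "decseq K" "range K \<subseteq> {K. A1_bound \<Omega> u w K}"
    and inf: "A1_const \<Omega> u w = (INF i. K i)"
    using ennreal_Inf_countable_INF unfolding A1_const_def by metis
  have lim: "K \<longlonglongrightarrow> A1_const \<Omega> u w" unfolding inf by (rule LIMSEQ_INF[OF K(1)])
  let ?I = "\<integral>\<^sup>+y. ennreal (u y) * indicator (ball c r) y \<partial>lebesgue_on \<Omega>"
  have "AE x in lebesgue_on \<Omega>. \<forall>i. x \<in> ball c r \<longrightarrow> ?I \<le> emeasure lebesgue (ball c r) * (K i * ennreal (w x))"
    unfolding AE_all_countable using K(2) by (intro allI A1_bound_majorant assms) auto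
  then show ?thesis
  proof eventually_elim
    case (elim x)
    \<comment> \<open>Multiplication by a finite factor is continuous on \<open>ennreal\<close>; the
      volume of the ball and \<open>w x\<close> are both finite.\<close>
    have "(\<lambda>i. emeasure lebesgue (ball c r) * ennreal (w x) * K i)
        \<longlonglongrightarrow> emeasure lebesgue (ball c r) * ennreal (w x) * A1_const \<Omega> u w"
      using emeasure_lebesgue_ball_bounds(2)[OF assms(3), of c]
      by (intro ennreal_tendsto_cmult lim) (simp add: less_top ennreal_mult_less_top del: emeasure_completion)
    then have "?I \<le> emeasure lebesgue (ball c r) * ennreal (w x) * A1_const \<Omega> u w" if "x \<in> ball c r"
      using elim that by (intro LIMSEQ_le_const) (auto simp: ac_simps simp del: emeasure_completion)
    then show ?case by (simp only: ac_simps) blast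
  qed
qed

text \<open>Lower semicontinuity: an average over a ball that exceeds \<open>a\<close> bounds the
  maximal function from below at every point of that ball.\<close>

lemma measurable_maximal_fun: "maximal_fun \<Omega> u \<in> borel_measurable borel"
proof (rule borel_measurableI_greater)
  fix a :: ennreal
  let ?avg = "\<lambda>c r. (\<integral>\<^sup>+y\<in>ball c r \<inter> \<Omega>. ennreal \<bar>u y\<bar> \<partial>lebesgue) / emeasure lebesgue (ball c r)"
  have "\<exists>T. open T \<and> x \<in> T \<and> T \<subseteq> {x. a < maximal_fun \<Omega> u x}" if x: "a < maximal_fun \<Omega> u x" for x
  proof -
    obtain c r where c: "0 < r" "x \<in> ball c r" "a < ?avg c r"
      using x unfolding maximal_fun_def less_SUP_iff by auto
    have "?avg c r \<le> maximal_fun \<Omega> u y" if "y \<in> ball c r" for y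
      unfolding maximal_fun_def using that c(1) by (intro SUP_upper2[of "(c, r)"]) simp_all
    then have "ball c r \<subseteq> {x. a < maximal_fun \<Omega> u x}" using c(3) by (auto intro: less_le_trans)
    then show ?thesis using c(2) open_ball by blast
  qed
  then have "open {x. a < maximal_fun \<Omega> u x}" by (subst open_subopen) simp
  then show "{x \<in> space borel. a < maximal_fun \<Omega> u x} \<in> sets borel" by simp
qed

text \<open>The ball itself competes in the supremum, so the bound holds at each of its points;
  nonnegativity of \<open>u\<close> on \<open>\<Omega>\<close> removes the absolute value.\<close>

lemma maximal_fun_majorant:
  assumes "open \<Omega>" "\<forall>x\<in>\<Omega>. 0 \<le> u x" "0 < r" "x \<in> ball c r"
  shows "(\<integral>\<^sup>+y. ennreal (u y) * indicator (ball c r) y \<partial>lebesgue_on \<Omega>)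
      \<le> emeasure lebesgue (ball c r) * maximal_fun \<Omega> u x"
proof (rule ennreal_divide_le_imp_le_mult[OF _ emeasure_lebesgue_ball_bounds[OF assms(3)]])
  have "(\<integral>\<^sup>+y\<in>ball c r \<inter> \<Omega>. ennreal (u y) \<partial>lebesgue) = (\<integral>\<^sup>+y\<in>ball c r \<inter> \<Omega>. ennreal \<bar>u y\<bar> \<partial>lebesgue)"
    using assms(2) by (intro nn_integral_cong) (auto split: split_indicator)
  then show "(\<integral>\<^sup>+y. ennreal (u y) * indicator (ball c r) y \<partial>lebesgue_on \<Omega>) / emeasure lebesgue (ball c r)
      \<le> maximal_fun \<Omega> u x"
    unfolding nn_integral_lebesgue_on_ball[OF assms(1)] maximal_fun_def
    using assms by (intro SUP_upper2[of "(c, r)"]) auto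
qed

theorem corollary1p3:
  fixes p \<gamma> :: real
  assumes "1 \<le> p"
    and "\<gamma> \<notin> {- real CARD('n::finite)..0}"
  shows "\<exists>C::real. 0 < C \<and>
    (\<forall>(\<Omega> :: (real ^ 'n) set) (f :: real ^ 'n \<Rightarrow> real) (l :: real).
       domain_set \<Omega> \<and> convex \<Omega> \<and> ball_dev \<Omega> < top \<and> C1_on \<Omega> f \<and> 0 < l \<longrightarrow>
         (\<forall>u w. A1_pair \<Omega> u w \<longrightarrow>
            emeasure (mu_meas \<Omega> \<gamma> u) (level_set \<Omega> l (\<gamma> / p) f)
              \<le> ennreal C * A1_const \<Omega> u w * ennreal ((enn2real (ball_dev \<Omega>) / l) powr p)
                 * (\<integral>\<^sup>+y\<in>\<Omega>. ennreal (norm (gradient f y) powr p * w y) \<partial>lebesgue)) \<and>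
         (\<forall>u. u locally_integrable_on \<Omega> \<and> (\<forall>x\<in>\<Omega>. 0 \<le> u x) \<longrightarrow>
            emeasure (mu_meas \<Omega> \<gamma> u) (level_set \<Omega> l (\<gamma> / p) f)
              \<le> ennreal C * ennreal ((enn2real (ball_dev \<Omega>) / l) powr p)
                 * (\<integral>\<^sup>+y\<in>\<Omega>. ennreal (norm (gradient f y) powr p) * maximal_fun \<Omega> u y \<partial>lebesgue)))"
proof -
  obtain C where "0 < C" and le: "\<forall>(\<Omega> :: (real ^ 'n) set) f l u W.
       convex \<Omega> \<and> ball_dev \<Omega> < top \<and> C1_on \<Omega> f \<and> 0 < l \<and>
       weighted_domain \<Omega> u (\<lambda>z. ennreal (norm (gradient f z) powr p)) W \<longrightarrow>
       emeasure (mu_meas \<Omega> \<gamma> u) (level_set \<Omega> l (\<gamma> / p) f) \<le>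
         ennreal C * ennreal ((enn2real (ball_dev \<Omega>) / l) powr p) *
           (\<integral>\<^sup>+x\<in>\<Omega>. ennreal (norm (gradient f x) powr p) * W x \<partial>lebesgue)"
    using level_set_le[OF assms] by (elim exE conjE) (rule that)
  note C = le[rule_format, OF conjI[OF _ conjI[OF _ conjI[OF _ conjI]]]]
  show ?thesis
  proof (intro exI[of _ C] conjI allI impI \<open>0 < C\<close>; elim conjE)
    fix \<Omega> :: "(real ^ 'n) set" and f :: "real ^ 'n \<Rightarrow> real" and l :: real and u w :: "real ^ 'n \<Rightarrow> real"
    assume \<Omega>: "domain_set \<Omega>" "convex \<Omega>" "ball_dev \<Omega> < top" "C1_on \<Omega> f" "0 < l" and uw: "A1_pair \<Omega> u w"
    have "open \<Omega>" using \<Omega>(1) by (simp add: domain_set_def)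
    let ?h = "\<lambda>x. ennreal (norm (gradient f x) powr p)"
    have w: "w \<in> borel_measurable (lebesgue_on \<Omega>)" "\<forall>x\<in>\<Omega>. 0 \<le> w x" and u: "u \<in> borel_measurable (lebesgue_on \<Omega>)"
      using uw by (auto simp: A1_pair_def weight_def)
    have h: "?h \<in> borel_measurable (lebesgue_on \<Omega>)"
      by (rule measurable_gradient_lebesgue_on[OF \<open>open \<Omega>\<close> \<Omega>(4)])
    \<comment> \<open>The A_1 constant is made part of the majorant here and is pulled out of the
      integral afterwards.\<close>
    have "weighted_domain \<Omega> u ?h (\<lambda>x. A1_const \<Omega> u w * ennreal (w x))"
      using w u h A1_const_majorant[OF \<open>open \<Omega>\<close> uw] \<open>open \<Omega>\<close> by unfold_locales auto
    from C[OF \<Omega>(2-5) this]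
    have "emeasure (mu_meas \<Omega> \<gamma> u) (level_set \<Omega> l (\<gamma> / p) f) \<le>
        ennreal C * ennreal ((enn2real (ball_dev \<Omega>) / l) powr p) *
          (\<integral>\<^sup>+x\<in>\<Omega>. ?h x * (A1_const \<Omega> u w * ennreal (w x)) \<partial>lebesgue)" .
    also have "(\<integral>\<^sup>+x\<in>\<Omega>. ?h x * (A1_const \<Omega> u w * ennreal (w x)) \<partial>lebesgue) =
        A1_const \<Omega> u w * (\<integral>\<^sup>+x\<in>\<Omega>. ennreal (norm (gradient f x) powr p * w x) \<partial>lebesgue)"
    proof -
      have "(\<integral>\<^sup>+x\<in>\<Omega>. ?h x * (A1_const \<Omega> u w * ennreal (w x)) \<partial>lebesgue) =
          (\<integral>\<^sup>+x. A1_const \<Omega> u w * (?h x * ennreal (w x)) \<partial>lebesgue_on \<Omega>)"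
        using \<open>open \<Omega>\<close> by (subst nn_integral_restrict_space) (auto simp: ac_simps)
      also have "\<dots> = A1_const \<Omega> u w * (\<integral>\<^sup>+x. ?h x * ennreal (w x) \<partial>lebesgue_on \<Omega>)"
        using h w by (intro nn_integral_cmult) simp
      also have "(\<integral>\<^sup>+x. ?h x * ennreal (w x) \<partial>lebesgue_on \<Omega>) =
          (\<integral>\<^sup>+x\<in>\<Omega>. ?h x * ennreal (w x) \<partial>lebesgue)"
        using \<open>open \<Omega>\<close> by (intro nn_integral_restrict_space) auto
      also have "\<dots> = (\<integral>\<^sup>+x\<in>\<Omega>. ennreal (norm (gradient f x) powr p * w x) \<partial>lebesgue)"
        using w(2) by (intro nn_integral_cong) (auto simp: ennreal_mult split: split_indicator)
      finally show ?thesis .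
    qed
    finally show "emeasure (mu_meas \<Omega> \<gamma> u) (level_set \<Omega> l (\<gamma> / p) f)
              \<le> ennreal C * A1_const \<Omega> u w * ennreal ((enn2real (ball_dev \<Omega>) / l) powr p)
                 * (\<integral>\<^sup>+y\<in>\<Omega>. ennreal (norm (gradient f y) powr p * w y) \<partial>lebesgue)"
      by (simp only: ac_simps)
  next
    fix \<Omega> :: "(real ^ 'n) set" and f :: "real ^ 'n \<Rightarrow> real" and l :: real and u :: "real ^ 'n \<Rightarrow> real"
    assume \<Omega>: "domain_set \<Omega>" "convex \<Omega>" "ball_dev \<Omega> < top" "C1_on \<Omega> f" "0 < l"
      and u: "u locally_integrable_on \<Omega>" "\<forall>x\<in>\<Omega>. 0 \<le> u x"
    have "open \<Omega>" using \<Omega>(1) by (simp add: domain_set_def)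
    have "maximal_fun \<Omega> u \<in> borel_measurable (lebesgue_on \<Omega>)"
      using measurable_maximal_fun by (intro measurable_restrict_space1 measurable_completion) simp
    then have "weighted_domain \<Omega> u (\<lambda>x. ennreal (norm (gradient f x) powr p)) (maximal_fun \<Omega> u)"
      using \<open>open \<Omega>\<close> u measurable_gradient_lebesgue_on[OF \<open>open \<Omega>\<close> \<Omega>(4)] maximal_fun_majorant[OF \<open>open \<Omega>\<close> u(2)]
      by unfold_locales (auto simp: locally_integrable_on_def)
    from C[OF \<Omega>(2-5) this]
    show "emeasure (mu_meas \<Omega> \<gamma> u) (level_set \<Omega> l (\<gamma> / p) f)
              \<le> ennreal C * ennreal ((enn2real (ball_dev \<Omega>) / l) powr p)
                 * (\<integral>\<^sup>+y\<in>\<Omega>. ennreal (norm (gradient f y) powr p) * maximal_fun \<Omega> u y \<partial>lebesgue)" .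
  qed
qed

end
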